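(* For every $n\ge0$, write $\Gamma_{Y_n}(z)=\sum_i g_{n,i}z^i$. Then $\Gamma_{Y_n}(z)\in\mathcal P_{\lfloor (n+1)/2\rfloor,\,n+1}$, i.e. $g_{n,i}$ is a positive integer for $\lfloor (n+1)/2\rfloor\le i\le n+1$ and $g_{n,i}=0$ otherwise. Moreover, the leading coefficient is $$g_{n,n+1}=4^n\sum_{k=0}^{\lfloor (n+1)/2\rfloor}\binom{n+2}{2k+1}3^k,$$ and for every $i$ with $\lfloor (n+1)/2\rfloor+1\le i\le n$ we have $g_{n,i}>11\,g_{n-1,i-1}$.
   Context: All embeddings are cellular embeddings in closed orientable surfaces, counted up to combinatorial equivalence (distinct rotation systems counted as distinct). The genus polynomial of a connected graph $G$ is $\Gamma_G(z)=\sum_{i\ge0}g_i(G)z^i$, where $g_i(G)$ is the number of embeddings of $G$ in the orientable surface of genus $i$. The iterated claws $Y_n$: $Y_0$ is the dipole $D_3$ (two vertices joined by three parallel edges) with root $u_0$ one of its vertices; for $n\ge1$, $Y_n$ (with root $u_n$) is obtained from $Y_{n-1}$ by subdividing each of the three edges incident on the root $u_{n-1}$ and joining the three new vertices to a new vertex $u_n$. For integers $s\le t$, $\mathcal P_{s,t}$ denotes the set of polynomials $\sum_{k=s}^t a_kz^k$ with every $a_k$ ($s\le k\le t$) a positive integer. *)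

theory Defs
  imports
    "Graph_Theory.Graph_Theory"
    "HOL-Combinatorics.Orbits"
    "HOL-Computational_Algebra.Polynomial"
begin

section \<open>Embeddings and the genus polynomial\<close>

text \<open>
  A finite undirected multigraph is a finite bidirected digraph \<open>G\<close> with arc reversal
  \<open>arev\<close>: an edge is a pair \<open>{a, arev a}\<close> of arcs. Cellular embeddings of a connected
  graph in closed oriented surfaces are given, up to combinatorial equivalence, by rotation
  systems: a cyclic order of the outgoing arcs at every vertex.
\<close>

definition rotation_system :: "('a, 'b) pre_digraph \<Rightarrow> ('b \<Rightarrow> 'b) \<Rightarrow> bool" where
  "rotation_system G \<rho> \<longleftrightarrow> \<rho> permutes arcs G \<and>
     (\<forall>v\<in>verts G. out_arcs G v \<noteq> {} \<longrightarrow> cyclic_on \<rho> (out_arcs G v))"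

text \<open>
  Face tracing: traverse an arc, then leave its head along the arc following the reversed one in
  the rotation. A one-vertex graph without edges has a single face, though no arc traces it.
\<close>

definition faces :: "('a, 'b) pre_digraph \<Rightarrow> ('b \<Rightarrow> 'b) \<Rightarrow> ('b \<Rightarrow> 'b) \<Rightarrow> 'b set set" where
  "faces G arev \<rho> = (if arcs G = {} then {{}} else orbit (\<rho> \<circ> arev) ` arcs G)"

definition euler_char :: "('a, 'b) pre_digraph \<Rightarrow> ('b \<Rightarrow> 'b) \<Rightarrow> ('b \<Rightarrow> 'b) \<Rightarrow> int" where
  "euler_char G arev \<rho> =
     int (card (verts G)) - int (card (arcs G) div 2) + int (card (faces G arev \<rho>))"

text \<open>The orientable surface of genus \<open>i\<close> is the one with Euler characteristic \<open>2 - 2i\<close>.\<close>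

definition embeddings :: "('a, 'b) pre_digraph \<Rightarrow> ('b \<Rightarrow> 'b) \<Rightarrow> nat \<Rightarrow> ('b \<Rightarrow> 'b) set" where
  "embeddings G arev i = {\<rho>. rotation_system G \<rho> \<and> euler_char G arev \<rho> = 2 - 2 * int i}"

definition num_embeddings :: "('a, 'b) pre_digraph \<Rightarrow> ('b \<Rightarrow> 'b) \<Rightarrow> nat \<Rightarrow> nat" where
  "num_embeddings G arev i = card (embeddings G arev i)"

definition genus_poly :: "('a, 'b) pre_digraph \<Rightarrow> ('b \<Rightarrow> 'b) \<Rightarrow> int poly" where
  "genus_poly G arev =
     (\<Sum>i | num_embeddings G arev i \<noteq> 0. monom (int (num_embeddings G arev i)) i)"

lemma coeff_genus_poly:
  assumes "finite (arcs G)"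
  shows "coeff (genus_poly G arev) i = int (num_embeddings G arev i)"
proof -
  let ?N = "num_embeddings G arev"
  let ?R = "{\<rho>. \<rho> permutes arcs G}"
  let ?g = "\<lambda>\<rho>. nat ((2 - euler_char G arev \<rho>) div 2)"
  have "{i. ?N i \<noteq> 0} \<subseteq> ?g ` ?R"
  proof
    fix i assume "i \<in> {i. ?N i \<noteq> 0}"
    then have "embeddings G arev i \<noteq> {}"
      by (auto simp: num_embeddings_def)
    then obtain \<rho> where "\<rho> permutes arcs G" "euler_char G arev \<rho> = 2 - 2 * int i"
      by (auto simp: embeddings_def rotation_system_def)
    then show "i \<in> ?g ` ?R"
      by (intro image_eqI[of _ _ \<rho>]) auto
  qed
  then have "finite {i. ?N i \<noteq> 0}"
    using finite_permutations[OF assms] by (meson finite_imageI finite_subset)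
  then show ?thesis
    by (simp add: genus_poly_def coeff_sum)
qed


section \<open>Iterated claws\<close>

text \<open>
  \<open>Root n\<close> is the vertex \<open>u\<^sub>n\<close>, \<open>Base\<close> the other vertex of the dipole \<open>Y\<^sub>0\<close>, and \<open>Mid n j\<close> the
  vertex subdividing the \<open>j\<close>-th edge at \<open>u\<^sub>n\<close> in the step from \<open>Y\<^sub>n\<close> to \<open>Y\<^sub>n\<^sub>+\<^sub>1\<close>. The label in the
  middle of an edge \<open>(x, j, y)\<close> keeps parallel edges apart; each edge is listed once, and an edge
  at the current root is listed as starting there, the three of them having the labels 0, 1, 2.
\<close>

datatype claw_vertex = Base | Root nat | Mid nat nat

type_synonym claw_arc = "claw_vertex \<times> nat \<times> claw_vertex"

primrec claw_verts :: "nat \<Rightarrow> claw_vertex set" where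
  "claw_verts 0 = {Base, Root 0}"
| "claw_verts (Suc n) = claw_verts n \<union> {Mid n j | j. j < 3} \<union> {Root (Suc n)}"

primrec claw_edges :: "nat \<Rightarrow> claw_arc set" where
  "claw_edges 0 = {(Root 0, j, Base) | j. j < 3}"
| "claw_edges (Suc n) =
     {(x, j, y) \<in> claw_edges n. x \<noteq> Root n}
     \<union> (\<Union>(j, y) \<in> {(j, y). (Root n, j, y) \<in> claw_edges n}.
          {(Root n, j, Mid n j), (Mid n j, j, y)})
     \<union> {(Root (Suc n), j, Mid n j) | j. j < 3}"

definition rev_arc :: "claw_arc \<Rightarrow> claw_arc" where
  "rev_arc = (\<lambda>(x, j, y). (y, j, x))"

definition iterated_claw :: "nat \<Rightarrow> (claw_vertex, claw_arc) pre_digraph" where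
  "iterated_claw n =
     \<lparr> verts = claw_verts n, arcs = claw_edges n \<union> rev_arc ` claw_edges n,
       tail = (\<lambda>(x, j, y). x), head = (\<lambda>(x, j, y). y) \<rparr>"

definition claw_rev :: "nat \<Rightarrow> claw_arc \<Rightarrow> claw_arc" where
  "claw_rev n a = (if a \<in> arcs (iterated_claw n) then rev_arc a else a)"

definition claw_genus_poly :: "nat \<Rightarrow> int poly" where
  "claw_genus_poly n = genus_poly (iterated_claw n) (claw_rev n)"

lemma finite_claw_verts: "finite (claw_verts n)"
  by (induction n) auto

lemma claw_verts_bounds: "Root m \<in> claw_verts n \<longleftrightarrow> m \<le> n" "Mid m j \<in> claw_verts n \<longleftrightarrow> m < n \<and> j < 3"
  by (induction n) auto

lemma claw_edges_wf:
  "(x, j, y) \<in> claw_edges n \<Longrightarrow>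
     x \<in> claw_verts n \<and> y \<in> claw_verts n - {Root n} \<and> x \<noteq> y \<and> j < 3"
proof (induction n arbitrary: x j y)
  case (Suc n)
  have "Root (Suc n) \<notin> claw_verts n" "\<And>i. Mid n i \<notin> claw_verts n"
    by (auto simp: claw_verts_bounds)
  with Suc show ?case
    by (fastforce simp: claw_verts_bounds)
qed auto

lemma claw_edges_at_root:
  "{e \<in> claw_edges n. fst e = Root n} =
     (\<lambda>j. (Root n, j, case n of 0 \<Rightarrow> Base | Suc m \<Rightarrow> Mid m j)) ` {..<3}"
proof (cases n)
  case (Suc m)
  show ?thesis
    unfolding Suc by (auto simp: claw_verts_bounds dest: claw_edges_wf)
qed auto

lemma finite_claw_edges: "finite (claw_edges n)"
proof (rule finite_subset)
  show "claw_edges n \<subseteq> claw_verts n \<times> {..<3} \<times> claw_verts n"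
    by (auto dest: claw_edges_wf)
qed (auto simp: finite_claw_verts)

lemma fin_digraph_iterated_claw: "fin_digraph (iterated_claw n)"
  by unfold_locales
    (auto simp: iterated_claw_def rev_arc_def finite_claw_verts finite_claw_edges
      dest: claw_edges_wf)

lemma bidirected_iterated_claw: "bidirected_digraph (iterated_claw n) (claw_rev n)"
proof -
  interpret fin_digraph "iterated_claw n"
    by (rule fin_digraph_iterated_claw)
  show ?thesis
    by (rule bidirected_digraphI)
      (auto simp: claw_rev_def iterated_claw_def rev_arc_def image_iff split: prod.splits
        dest: claw_edges_wf)
qed


section \<open>Polynomials with positive coefficients in a range of degrees\<close>

definition pos_polys :: "nat \<Rightarrow> nat \<Rightarrow> int poly set" where
  "pos_polys s t = {\<Sum>k=s..t. monom (a k) k | a. \<forall>k\<in>{s..t}. 0 < a k}"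

end

theory Submission
  imports Defs
begin

text \<open>
  Cut \<open>Y\<^sub>n\<close> open at its root. A rotation system of the remaining vertices leaves a certain number \<open>f\<close> of
  closed faces and three face segments that match the three entries at the root with the three
  exits by a permutation of three elements. Attaching the next claw changes this pair in a way
  that can be tabulated; only the conjugacy class of the permutation (identity, transposition,
  3-cycle) matters, and the numbers of rotation systems in the three classes satisfy a linear
  recurrence. With coefficients counted downwards from the top degree, \<open>c\<^sub>n(j) = g\<^sub>n\<^sub>,\<^sub>n\<^sub>+\<^sub>1\<^sub>-\<^sub>j\<close>, it gives
  \<open>c\<^sub>n\<^sub>+\<^sub>3(j) = 20 c\<^sub>n\<^sub>+\<^sub>2(j) - 64 c\<^sub>n\<^sub>+\<^sub>1(j) - 384 c\<^sub>n(j) + 24 c\<^sub>n\<^sub>+\<^sub>1(j - 1)\<close>, from which the bound on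
  \<open>g\<^sub>n\<^sub>,\<^sub>i / g\<^sub>n\<^sub>-\<^sub>1\<^sub>,\<^sub>i\<^sub>-\<^sub>1\<close> follows by induction, and for \<open>j = 0\<close> the characteristic polynomial has the roots
  \<open>4 (1 \<plusminus> \<surd>3)\<close> that explain the leading coefficients.
\<close>

section \<open>Orbits of a permutation after removing points\<close>

text \<open>Takes \<open>a\<close> out of its cycle: the predecessor of \<open>a\<close> is sent
  straight to \<open>f a\<close>, and \<open>a\<close> becomes fixed. Written as a transposition
  after \<open>f\<close>, it is visibly a permutation whenever \<open>f\<close> is.\<close>

definition skip :: "'a \<Rightarrow> ('a \<Rightarrow> 'a) \<Rightarrow> 'a \<Rightarrow> 'a" where
  "skip a f = transpose a (f a) \<circ> f"

definition num_orbits :: "('a \<Rightarrow> 'a) \<Rightarrow> 'a set \<Rightarrow> nat" where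
  "num_orbits f A = card (orbit f ` A)"

lemma skip_apply:
  assumes "inj f"
  shows "skip a f x = (if x = a then a else if f x = a then f a else f x)"
  using injD[OF assms, of x a] by (auto simp: skip_def transpose_def)

lemma skip_permutes:
  assumes "f permutes A"
  shows "skip a f permutes A - {a}"
proof (cases "a \<in> A")
  case True
  then have "skip a f permutes A"
    unfolding skip_def
    using assms by (intro permutes_compose permutes_swap_id) (auto simp: permutes_in_image)
  then show ?thesis
    by (rule permutes_superset) (auto simp: skip_def transpose_def)
next
  case False
  then show ?thesis
    using assms permutes_not_in[OF assms False] by (simp add: skip_def)
qed

text \<open>Since \<open>\<kappa>\<close> fixes \<open>a\<close>, removing \<open>a\<close> from the
  composite affects only the inner factor. A large unknown \<open>\<kappa>\<close> can thus stay
  untouched while points are removed from an explicit \<open>f\<close>.\<close>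

lemma skip_comp:
  assumes "\<kappa> permutes A - {a}" "inj f"
  shows "skip a (\<kappa> \<circ> f) = \<kappa> \<circ> skip a f"
proof
  fix x
  have \<kappa>: "\<kappa> a = a" "inj \<kappa>"
    using assms(1) permutes_not_in[OF assms(1)] permutes_inj by auto
  then have iff: "\<kappa> y = a \<longleftrightarrow> y = a" for y
    by (metis injD)
  then show "skip a (\<kappa> \<circ> f) x = (\<kappa> \<circ> skip a f) x"
    using \<kappa>(2) assms(2) by (auto simp: skip_apply inj_compose iff \<kappa>(1))
qed

lemma orbit_skip:
  assumes "inj f" "f a \<noteq> a" "x \<noteq> a"
  shows "orbit (skip a f) x = orbit f x - {a}"
proof (intro equalityI subsetI)
  fix y assume "y \<in> orbit (skip a f) x"
  then show "y \<in> orbit f x - {a}"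
  proof induction
    case base
    then show ?case
      using assms by (auto simp: skip_apply intro: orbit.intros)
  next
    case (step y)
    then show ?case
      using assms by (auto simp: skip_apply intro: orbit.intros)
  qed
next
  fix y assume y: "y \<in> orbit f x - {a}"
  \<comment> \<open>The claim is strengthened to cover \<open>y = a\<close>: an orbit that meets
    \<open>a\<close> continues at \<open>f a\<close>, which stands in for it.\<close>
  have "y \<in> orbit f x \<Longrightarrow> (if y = a then f a else y) \<in> orbit (skip a f) x" for y
  proof (induction rule: orbit.induct)
    case base
    then show ?case
      using assms orbit.base[of "skip a f" x] by (auto simp: skip_apply[of f a x])
  next
    case (step y)
    show ?case
    proof (cases "y = a")
      case False
      then have "(if f y = a then f a else f y) = skip a f y"
        using assms by (simp add: skip_apply)
      then show ?thesis
        using False step.IH orbit.step[of y "skip a f" x] by simp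
    qed (use assms step in auto)
  qed
  from this[of y] y show "y \<in> orbit (skip a f) x" by auto
qed

text \<open>A cycle shortened by one point remains a cycle, unless it consisted of the fixed point
  \<open>a\<close> alone.\<close>

lemma num_orbits_skip:
  assumes f: "f permutes A" and "finite A" "a \<in> A"
  shows "num_orbits f A = num_orbits (skip a f) (A - {a}) + of_bool (f a = a)"
proof -
  have inj: "inj f"
    using f by (rule permutes_inj)
  have self: "x \<in> orbit f x" for x
    using f \<open>finite A\<close> by (intro permutation_self_in_orbit) (auto simp: permutation_permutes)
  have eq: "orbit f x = orbit f y" if "x \<in> orbit f y" for x y
    using that self by (metis orbit_cyclic_eq3 cyclic_on_orbit' f \<open>finite A\<close> permutation_permutes)
  show ?thesis
  proof (cases "f a = a")
    case True
    have "orbit f a = {a}"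
      using True by (simp add: orbit_eq_singleton_iff)
    moreover have "orbit f a \<notin> orbit f ` (A - {a})"
      using self calculation by auto
    moreover have "skip a f = f"
      using True by (simp add: skip_def)
    moreover have "orbit f ` A = insert (orbit f a) (orbit f ` (A - {a}))"
      using \<open>a \<in> A\<close> by blast
    ultimately show ?thesis
      using \<open>finite A\<close> True by (simp add: num_orbits_def)
  next
    case False
    have "orbit f a = orbit f (f a)"
      using eq[OF orbit.base[of f a]] by simp
    then have 1: "orbit f ` A = orbit f ` (A - {a})"
      using False \<open>a \<in> A\<close> permutes_in_image[OF f, of a] by (auto simp: image_iff)
    have "orbit (skip a f) ` (A - {a}) = (\<lambda>X. X - {a}) ` orbit f ` (A - {a})"
      unfolding image_image using inj False by (intro image_cong) (auto simp: orbit_skip)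
    \<comment> \<open>Each of these orbits has a point other than \<open>a\<close>, and that point
      determines the orbit.\<close>
    moreover have "inj_on (\<lambda>X. X - {a}) (orbit f ` (A - {a}))"
    proof (rule inj_onI; elim imageE)
      fix X Y x y
      assume *: "X - {a} = Y - {a}" "X = orbit f x" "Y = orbit f y" "x \<in> A - {a}" "y \<in> A - {a}"
      then have "x \<in> orbit f y"
        using self[of x] by blast
      then show "X = Y"
        using eq * by simp
    qed
    ultimately show ?thesis
      using False 1 by (simp add: num_orbits_def card_image)
  qed
qed

text \<open>Relabelling carries cycles to cycles; this moves face counts from the darts to the arcs
  of the graph.\<close>

lemma num_orbits_conjugate:
  assumes h: "bij_betw h A B" and f: "f permutes A"
    and comm: "\<And>x. x \<in> A \<Longrightarrow> g (h x) = h (f x)"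
  shows "card (orbit g ` B) = num_orbits f A"
proof -
  have sub: "orbit f x \<subseteq> A" if "x \<in> A" for x
    using that f by (simp add: permutes_orbit_subset)
  have orb: "orbit g (h x) = h ` orbit f x" if "x \<in> A" for x
  proof (intro equalityI subsetI)
    fix y assume "y \<in> orbit g (h x)"
    then show "y \<in> h ` orbit f x"
    proof induction
      case base
      then show ?case using comm that by (auto intro: orbit.base)
    next
      case (step y)
      then show ?case using comm sub[OF that] by (auto intro!: imageI orbit.step)
    qed
  next
    fix y assume "y \<in> h ` orbit f x"
    then obtain z where "z \<in> orbit f x" "y = h z" by auto
    then have "h z \<in> orbit g (h x)"
    proof (induction arbitrary: y)
      case base
      then show ?case using comm[OF that] orbit.base[of g "h x"] by simp
    next
      case (step z)
      then show ?case using comm[of z] sub[OF that] orbit.step[of "h z" g "h x"] by auto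
    qed
    then show "y \<in> orbit g (h x)" by (simp add: \<open>y = h z\<close>)
  qed
  have "B = h ` A"
    using h by (simp add: bij_betw_def)
  then have "orbit g ` B = (`) h ` orbit f ` A"
    using orb by (simp add: image_image)
  moreover have "inj_on ((`) h) (orbit f ` A)"
  proof (rule inj_on_subset[OF inj_on_image_Pow])
    show "inj_on h A" using h by (simp add: bij_betw_def)
    show "orbit f ` A \<subseteq> Pow A" using sub by auto
  qed
  ultimately show ?thesis
    by (simp add: num_orbits_def card_image)
qed

text \<open>
  A permutation of finitely many named points \<open>e 0, e 1, \<dots>\<close> is represented by the list of the
  indices of the images. The second component of \<open>reduce\<close> counts the orbits that disappear.
\<close>

definition skip_list :: "nat \<Rightarrow> nat list \<Rightarrow> nat list" where
  "skip_list a xs = (map (\<lambda>y. if y = a then xs ! a else y) xs)[a := a]"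

primrec reduce :: "nat list \<Rightarrow> nat list \<Rightarrow> nat list \<times> nat" where
  "reduce [] xs = (xs, 0)"
| "reduce (a # as) xs =
     (case reduce as (skip_list a xs) of (ys, d) \<Rightarrow> (ys, d + (if xs ! a = a then 1 else 0)))"

definition realizes :: "(nat \<Rightarrow> 'a) \<Rightarrow> nat list \<Rightarrow> ('a \<Rightarrow> 'a) \<Rightarrow> bool" where
  "realizes e xs g \<longleftrightarrow> (\<forall>i < length xs. g (e i) = e (xs ! i))
     \<and> (\<forall>d. d \<notin> e ` {..<length xs} \<longrightarrow> g d = d)"

lemma realizes_unique:
  assumes "realizes e xs g" "realizes e xs h"
  shows "g = h"
proof
  fix x show "g x = h x"
    using assms by (cases "x \<in> e ` {..<length xs}") (auto simp: realizes_def)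
qed

lemma realizes_permutes:
  assumes "realizes e xs g" "distinct xs" "set xs \<subseteq> {..<length xs}"
  shows "g permutes e ` {..<length xs}"
proof -
  \<comment> \<open>Pigeonhole; afterwards, a finite self-map that is onto is bijective.\<close>
  have "set xs = {..<length xs}"
    using assms(2,3) by (metis card_lessThan card_subset_eq distinct_card finite_lessThan)
  then have "(!) xs ` {..<length xs} = {..<length xs}"
    by (auto simp: set_conv_nth image_iff)
  moreover have "g ` e ` {..<length xs} = e ` (!) xs ` {..<length xs}"
    using assms(1) unfolding image_image by (intro image_cong) (auto simp: realizes_def)
  ultimately have "g ` e ` {..<length xs} = e ` {..<length xs}"
    by simp
  then have "bij_betw g (e ` {..<length xs}) (e ` {..<length xs})"
    by (simp add: bij_betw_def eq_card_imp_inj_on)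
  then show ?thesis
    using assms(1) by (intro bij_imp_permutes) (auto simp: realizes_def)
qed

lemma realizes_skip:
  assumes g: "realizes e xs g" and "inj g" "inj_on e {..<length xs}"
    and "set xs \<subseteq> {..<length xs}" "a < length xs"
  shows "realizes e (skip_list a xs) (skip (e a) g)"
proof -
  have [simp]: "length (skip_list a xs) = length xs"
    by (simp add: skip_list_def)
  have xs: "xs ! i < length xs" if "i < length xs" for i
    using assms(4) that by (metis lessThan_iff nth_mem subsetD)
  have e: "e i = e j \<longleftrightarrow> i = j" if "i < length xs" "j < length xs" for i j
    using assms(3) that by (auto dest: inj_onD)
  have "d = e a \<or> g d = d" if "d \<notin> e ` {..<length xs}" for d
    using that g by (auto simp: realizes_def)
  then show ?thesis
    using assms xs e by (auto simp: realizes_def skip_apply skip_list_def nth_list_update)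
qed

lemma set_skip_list:
  assumes "set xs \<subseteq> {..<length xs}" "a < length xs"
  shows "set (skip_list a xs) \<subseteq> {..<length (skip_list a xs)}"
  using assms set_update_subset_insert[of "map (\<lambda>y. if y = a then xs ! a else y) xs" a a]
  by (auto simp: skip_list_def subset_iff)

text \<open>Transfers a list computation to a permutation of which only the factor \<open>g\<close>
  is explicit. Each removal is one use of \<open>num_orbits_skip\<close>; as \<open>\<kappa>\<close>
  fixes the removed points, an orbit is lost exactly when \<open>xs ! a = a\<close>.\<close>

lemma num_orbits_reduce:
  assumes "finite A" "g permutes A" "\<kappa> permutes A - e ` set as"
    and "realizes e xs g" "inj_on e {..<length xs}"
    and "set xs \<subseteq> {..<length xs}" "set as \<subseteq> {..<length xs}" "e ` set as \<subseteq> A" "distinct as"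
    and "reduce as xs = (ys, d)"
  shows "\<exists>h. realizes e ys h
           \<and> num_orbits (\<kappa> \<circ> g) A = d + num_orbits (\<kappa> \<circ> h) (A - e ` set as)"
  using assms
proof (induction as arbitrary: A g xs ys d)
  case Nil
  then show ?case by auto
next
  case (Cons a as)
  have [simp]: "length (skip_list a xs) = length xs"
    by (simp add: skip_list_def)
  obtain d' where d': "reduce as (skip_list a xs) = (ys, d')" "d = d' + of_bool (xs ! a = a)"
    using Cons.prems(10) by (auto split: prod.splits)
  have a: "a < length xs" "e a \<in> A"
    using Cons.prems(7,8) by auto
  have e: "e i = e j \<longleftrightarrow> i = j" if "i < length xs" "j < length xs" for i j
    using Cons.prems(5) that by (auto dest: inj_onD)
  have "e a \<notin> e ` set as"
    using Cons.prems(7,9) a e by (auto simp: subset_iff)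
  note inj = permutes_inj[OF Cons.prems(2)]
  have \<kappa>: "\<kappa> permutes A - {e a}"
    using Cons.prems(3) by (rule permutes_subset) auto
  then have \<kappa>A: "\<kappa> permutes A"
    by (rule permutes_subset) auto
  have diff: "A - {e a} - e ` set as = A - e ` set (a # as)"
    by auto
  have "\<exists>h. realizes e ys h \<and> num_orbits (\<kappa> \<circ> skip (e a) g) (A - {e a})
        = d' + num_orbits (\<kappa> \<circ> h) (A - {e a} - e ` set as)"
  proof (intro Cons.IH[where xs = "skip_list a xs"])
    show "realizes e (skip_list a xs) (skip (e a) g)"
      using Cons.prems(4) inj Cons.prems(5,6) a(1) by (rule realizes_skip)
    show "set (skip_list a xs) \<subseteq> {..<length (skip_list a xs)}"
      using Cons.prems(6) a(1) by (rule set_skip_list)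
    show "e ` set as \<subseteq> A - {e a}"
      using Cons.prems(8) \<open>e a \<notin> e ` set as\<close> by (simp add: subset_Diff_insert)
    show "\<kappa> permutes A - {e a} - e ` set as"
      using Cons.prems(3) diff by simp
    show "skip (e a) g permutes A - {e a}"
      using Cons.prems(2) by (rule skip_permutes)
  qed (use Cons.prems d' in auto)
  then obtain h where h: "realizes e ys h" "num_orbits (\<kappa> \<circ> skip (e a) g) (A - {e a})
        = d' + num_orbits (\<kappa> \<circ> h) (A - e ` set (a # as))"
    unfolding diff by blast
  moreover have "num_orbits (\<kappa> \<circ> g) A
      = num_orbits (\<kappa> \<circ> skip (e a) g) (A - {e a}) + of_bool ((\<kappa> \<circ> g) (e a) = e a)"
    using num_orbits_skip[of "\<kappa> \<circ> g" A "e a"] skip_comp[OF \<kappa> inj]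
      permutes_compose[OF Cons.prems(2) \<kappa>A] Cons.prems(1) a by simp
  moreover have "(\<kappa> \<circ> g) (e a) = e a \<longleftrightarrow> xs ! a = a"
  proof -
    have "\<kappa> (e a) = e a"
      using \<kappa> by (simp add: permutes_not_in)
    then have "\<kappa> y = e a \<longleftrightarrow> y = e a" for y
      using permutes_inj[OF \<kappa>] by (metis injD)
    moreover have "xs ! a < length xs"
      using Cons.prems(6) a by (metis lessThan_iff nth_mem subsetD)
    ultimately show ?thesis
      using Cons.prems(4) a e by (simp add: realizes_def)
  qed
  ultimately have "num_orbits (\<kappa> \<circ> g) A = d + num_orbits (\<kappa> \<circ> h) (A - e ` set (a # as))"
    using d'(2) h(2) by (simp only:)
  with h(1) show ?case
    by blast
qed

section \<open>Attaching a claw\<close>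

text \<open>The two values of \<open>b\<close> give the two 3-cycles, the only rotations at a cubic
  vertex.\<close>

definition turn :: "bool \<Rightarrow> nat \<Rightarrow> nat" where
  "turn b j = (if b then j + 1 else j + 2) mod 3"

text \<open>
  The fifteen darts involved when the claw with centre \<open>Root n\<close> is closed up have the following
  indices: \<open>j\<close> is the dart at the new root, \<open>3 + j\<close> and \<open>6 + j\<close> leave \<open>Mid n j\<close> downwards and towards
  \<open>Root n\<close>, \<open>9 + j\<close> leaves it towards the new root, and \<open>12 + j\<close> leaves \<open>Root n\<close>. The booleans are the
  orientations of the four vertices, and the new root is left without a rotation.
\<close>

definition claw_word :: "bool \<Rightarrow> bool \<Rightarrow> bool \<Rightarrow> bool \<Rightarrow> nat list" where
  "claw_word r m0 m1 m2 =
     map (\<lambda>(m, j). if m then 3 + j else 6 + j) [(m0, 0), (m1, 1), (m2, 2)]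
     @ map (\<lambda>(m, j). if m then 6 + j else 9 + j) [(m0, 0), (m1, 1), (m2, 2)]
     @ map (\<lambda>j. 12 + turn r j) [0, 1, 2]
     @ [0, 1, 2]
     @ map (\<lambda>(m, j). if m then 9 + j else 3 + j) [(m0, 0), (m1, 1), (m2, 2)]"

text \<open>The strand permutation acts on the indices 3, 4, 5 of the old ports; the identity
  elsewhere pads it so that it composes with \<open>claw_word\<close>.\<close>

definition port_word :: "nat list \<Rightarrow> nat list" where
  "port_word p = [0, 1, 2] @ map ((+) 3) p @ [6, 7, 8, 9, 10, 11, 12, 13, 14]"

definition claw_reduce :: "nat list \<Rightarrow> bool \<Rightarrow> bool \<Rightarrow> bool \<Rightarrow> bool \<Rightarrow> nat list \<times> nat" where
  "claw_reduce p r m0 m1 m2 =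
     reduce [3, 4, 5, 6, 7, 8, 9, 10, 11, 12, 13, 14]
       (map ((!) (claw_word r m0 m1 m2)) (port_word p))"

definition perms3 :: "nat list set" where
  "perms3 = {[0, 1, 2], [0, 2, 1], [1, 0, 2], [1, 2, 0], [2, 0, 1], [2, 1, 0]}"

text \<open>On \<open>perms3\<close> the value is 3 minus the number of cycles.\<close>

definition perm_class :: "nat list \<Rightarrow> nat" where
  "perm_class p = (if p = [0, 1, 2] then 0 else if p = [1, 2, 0] \<or> p = [2, 0, 1] then 2 else 1)"

definition turn_reduce :: "bool \<Rightarrow> nat list \<Rightarrow> nat list \<times> nat" where
  "turn_reduce r p = reduce [0, 1, 2] (map (turn r) p)"

lemmas claw_reduce_simps =
  claw_reduce_def claw_word_def port_word_def skip_list_def turn_def perm_class_def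

text \<open>Removed indices end up fixed, so only the action on the new ports 0, 1, 2 carries
  information. All 96 cases are evaluated.\<close>

lemma claw_reduce_ports:
  assumes "p \<in> perms3"
  shows "case claw_reduce p r m0 m1 m2 of (ys, d) \<Rightarrow>
    take 3 ys \<in> perms3 \<and> drop 3 ys = [3, 4, 5, 6, 7, 8, 9, 10, 11, 12, 13, 14]"
  using assms unfolding perms3_def insert_iff empty_iff
  by (elim disjE FalseE; hypsubst; cases r; cases m0; cases m1; cases m2; simp add: claw_reduce_simps)

text \<open>The transfer matrix, acting on a test function \<open>h\<close>: each row distributes
  the 16 orientations of the four new vertices over the resulting classes, and \<open>f + 1\<close>
  marks a newly closed face.\<close>

definition class_sum :: "(nat \<Rightarrow> nat \<Rightarrow> nat) \<Rightarrow> nat \<Rightarrow> nat \<Rightarrow> nat" where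
  "class_sum h k f =
     (if k = 0 then 16 * h 2 f
      else if k = 1 then 12 * h 1 f + 4 * h 2 (f + 1)
      else 2 * h 0 f + 6 * h 1 (f + 1) + 8 * h 2 f)"

lemma sum_claw_reduce:
  assumes "p \<in> perms3"
  shows "(\<Sum>r\<in>UNIV. \<Sum>m0\<in>UNIV. \<Sum>m1\<in>UNIV. \<Sum>m2\<in>UNIV.
      h (perm_class (take 3 (fst (claw_reduce p r m0 m1 m2)))) (f + snd (claw_reduce p r m0 m1 m2)))
    = class_sum h (perm_class p) f"
proof -
  have UNIV_sum: "(\<Sum>b\<in>UNIV. g b) = g False + g True" for g :: "bool \<Rightarrow> nat"
    by (simp add: UNIV_bool)
  show ?thesis
    using assms unfolding perms3_def insert_iff empty_iff UNIV_sum
    by (elim disjE FalseE; hypsubst; simp add: claw_reduce_simps class_sum_def)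
qed

text \<open>Closing up multiplies \<open>p\<close> by the 3-cycle of the root. A transposition stays
  a transposition; a 3-cycle becomes the identity exactly when the root turns by its inverse, and
  \<open>[2, 0, 1]\<close> is inverse to \<open>turn True\<close>.\<close>

lemma turn_reduce_count:
  assumes "p \<in> perms3"
  shows "snd (turn_reduce r p) = (if perm_class p = 0 then 1 else if perm_class p = 1 then 2
    else if r = (p = [2, 0, 1]) then 3 else 1)"
  using assms unfolding perms3_def insert_iff empty_iff
  by (elim disjE FalseE; hypsubst; cases r; simp add: claw_reduce_simps turn_reduce_def)

section \<open>Faces of the cut graph\<close>

text \<open>
  Unlike the arcs of \<open>iterated_claw n\<close>, the darts keep their names when the graph grows: \<open>Down l j\<close> is
  the arc from \<open>Root n\<close> (if \<open>l = n\<close>) or \<open>Mid l j\<close> (if \<open>l < n\<close>) to the vertex below it and \<open>Up l j\<close> its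
  reverse; \<open>Out l j\<close> runs from \<open>Root l\<close> to \<open>Mid l j\<close> and \<open>In l j\<close> is its reverse.
  A set \<open>S\<close> of vertices encodes a rotation system: it contains the vertices turning \<open>0, 1, 2\<close>.
\<close>

datatype dart = Down nat nat | Up nat nat | Out nat nat | In nat nat

definition darts :: "nat \<Rightarrow> dart set" where
  "darts n = {Down l j | l j. l \<le> n \<and> j < 3} \<union> {Up l j | l j. l \<le> n \<and> j < 3}
     \<union> {Out l j | l j. l < n \<and> j < 3} \<union> {In l j | l j. l < n \<and> j < 3}"

definition ports :: "nat \<Rightarrow> dart set" where
  "ports n = Down n ` {..<3}"

text \<open>\<open>cut_perm n\<close> fixes the new darts and reaches the open port
  \<open>Down n j\<close> only from \<open>Up n j\<close>. Composing on the left with this map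
  therefore redirects the strands at \<open>Mid n j\<close> and inserts the new darts, and alters no
  other step of a face.\<close>

definition attach_claw :: "nat \<Rightarrow> claw_vertex set \<Rightarrow> dart \<Rightarrow> dart" where
  "attach_claw n S d = (case d of
     Down l j \<Rightarrow>
       if l = n \<and> j < 3 then (if Mid n j \<in> S then In n j else Up (Suc n) j)
       else if l = Suc n \<and> j < 3 then (if Mid n j \<in> S then Down n j else In n j) else d
   | Up l j \<Rightarrow> if l = Suc n \<and> j < 3 then Down (Suc n) j else d
   | Out l j \<Rightarrow> if l = n \<and> j < 3 then (if Mid n j \<in> S then Up (Suc n) j else Down n j) else d
   | In l j \<Rightarrow> if l = n \<and> j < 3 then Out n (turn (Root n \<in> S) j) else d)"

definition base_perm :: "claw_vertex set \<Rightarrow> dart \<Rightarrow> dart" where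
  "base_perm S d = (case d of
     Down l j \<Rightarrow> if l = 0 \<and> j < 3 then Up 0 (turn (Base \<in> S) j) else d
   | Up l j \<Rightarrow> if l = 0 \<and> j < 3 then Down 0 j else d
   | _ \<Rightarrow> d)"

text \<open>
  The face permutation of \<open>Y\<^sub>n\<close>, except that the darts at \<open>Root n\<close> are not rotated.
\<close>

primrec cut_perm :: "nat \<Rightarrow> claw_vertex set \<Rightarrow> dart \<Rightarrow> dart" where
  "cut_perm 0 S = base_perm S"
| "cut_perm (Suc n) S = attach_claw n S \<circ> cut_perm n S"

definition port_perm :: "nat \<Rightarrow> nat list \<Rightarrow> dart \<Rightarrow> dart" where
  "port_perm n p d = (case d of Down l j \<Rightarrow> if l = n \<and> j < 3 then Down n (p ! j) else d | _ \<Rightarrow> d)"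

text \<open>
  The matching of the three strands at the root and the number of faces avoiding the root.
\<close>

primrec cut_state :: "nat \<Rightarrow> claw_vertex set \<Rightarrow> nat list \<times> nat" where
  "cut_state 0 S = (map (turn (Base \<in> S)) [0, 1, 2], 0)"
| "cut_state (Suc n) S =
     (case cut_state n S of (p, f) \<Rightarrow>
        case claw_reduce p (Root n \<in> S) (Mid n 0 \<in> S) (Mid n 1 \<in> S) (Mid n 2 \<in> S) of (ys, d) \<Rightarrow>
          (take 3 ys, f + d))"

definition claw_dart :: "nat \<Rightarrow> nat \<Rightarrow> dart" where
  "claw_dart n i = (if i < 3 then Down (Suc n) i else if i < 6 then Down n (i - 3)
     else if i < 9 then In n (i - 6) else if i < 12 then Up (Suc n) (i - 9) else Out n (i - 12))"

definition claw_darts :: "nat \<Rightarrow> dart set" where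
  "claw_darts n = Up (Suc n) ` {..<3} \<union> Out n ` {..<3} \<union> In n ` {..<3}"

lemma lessThan_3: "{..<3} = {0, 1, 2 :: nat}"
  by auto

lemma less_3_iff: "j < 3 \<longleftrightarrow> j = 0 \<or> j = 1 \<or> j = (2 :: nat)"
  by auto

lemma lessThan_15: "{..<15} = {0, 1, 2, 3, 4, 5, 6, 7, 8, 9, 10, 11, 12, 13, 14 :: nat}"
  by (auto simp: lessThan_nat_numeral)

lemma turn_less [simp]: "turn b j < 3"
  by (simp add: turn_def)

lemma finite_darts: "finite (darts n)"
proof -
  have "darts n = case_prod Down ` ({..n} \<times> {..<3}) \<union> case_prod Up ` ({..n} \<times> {..<3})
    \<union> case_prod Out ` ({..<n} \<times> {..<3}) \<union> case_prod In ` ({..<n} \<times> {..<3})"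
    by (auto simp: darts_def)
  then show ?thesis by simp
qed

lemma darts_0: "darts 0 = ports 0 \<union> Up 0 ` {..<3}"
  by (auto simp: darts_def ports_def)

lemma darts_Suc: "darts (Suc n) = darts n \<union> ports (Suc n) \<union> claw_darts n"
  by (auto simp: darts_def ports_def claw_darts_def le_Suc_eq less_Suc_eq)

lemma inj_claw_dart: "inj_on (claw_dart n) {..<15}"
  by (auto simp: inj_on_def claw_dart_def split: if_splits)

lemma claw_dart_image: "claw_dart n ` {..<15} = ports (Suc n) \<union> ports n \<union> claw_darts n"
  unfolding lessThan_15 ports_def claw_darts_def lessThan_3 by (auto simp: claw_dart_def)

lemma claw_dart_image_skipped:
  "claw_dart n ` set [3, 4, 5, 6, 7, 8, 9, 10, 11, 12, 13, 14] = ports n \<union> claw_darts n"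
  unfolding ports_def claw_darts_def lessThan_3 by (auto simp: claw_dart_def)

lemma realizes_attach_claw:
  "realizes (claw_dart n) (claw_word (Root n \<in> S) (Mid n 0 \<in> S) (Mid n 1 \<in> S) (Mid n 2 \<in> S))
     (attach_claw n S)"
proof -
  let ?w = "claw_word (Root n \<in> S) (Mid n 0 \<in> S) (Mid n 1 \<in> S) (Mid n 2 \<in> S)"
  have len: "length ?w = 15"
    by (simp add: claw_word_def)
  have "attach_claw n S (claw_dart n i) = claw_dart n (?w ! i)" if "i < 15" for i
  proof -
    have "i \<in> {..<15}"
      using that by simp
    then show ?thesis
      unfolding lessThan_15 insert_iff empty_iff
      by (elim disjE FalseE; simp add: claw_word_def claw_dart_def attach_claw_def turn_def)
  qed
  moreover have "attach_claw n S d = d" if "d \<notin> claw_dart n ` {..<15}" for d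
    using that unfolding claw_dart_image
    by (auto simp: ports_def claw_darts_def attach_claw_def split: dart.splits)
  ultimately show ?thesis
    unfolding realizes_def len by blast
qed

lemma realizes_port_perm:
  assumes "p \<in> perms3"
  shows "realizes (claw_dart n) (port_word p) (port_perm n p)"
proof -
  have len: "length (port_word p) = 15"
    using assms by (auto simp: port_word_def perms3_def)
  have "port_perm n p (claw_dart n i) = claw_dart n (port_word p ! i)" if "i < 15" for i
  proof -
    have "i \<in> {..<15}"
      using that by simp
    then show ?thesis
      using assms unfolding lessThan_15 insert_iff empty_iff perms3_def
      by (elim disjE FalseE; simp add: port_word_def claw_dart_def port_perm_def)
  qed
  moreover have "port_perm n p d = d" if "d \<notin> claw_dart n ` {..<15}" for d
    using that unfolding claw_dart_image
    by (auto simp: ports_def claw_darts_def port_perm_def split: dart.splits)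
  ultimately show ?thesis
    by (simp add: realizes_def len)
qed

lemma claw_word_perm:
  "length (claw_word r m0 m1 m2) = 15" "distinct (claw_word r m0 m1 m2)"
  "set (claw_word r m0 m1 m2) \<subseteq> {..<15}"
  by (cases r; cases m0; cases m1; cases m2; simp add: claw_word_def turn_def)+

lemma port_word_perm:
  assumes "p \<in> perms3"
  shows "length (port_word p) = 15" "distinct (port_word p)" "set (port_word p) \<subseteq> {..<15}"
  using assms by (auto simp: port_word_def perms3_def)

lemma realizes_comp:
  assumes "realizes e xs g" "realizes e ys h" "length xs = length ys" "set ys \<subseteq> {..<length ys}"
  shows "realizes e (map ((!) xs) ys) (g \<circ> h)"
proof -
  have "ys ! i < length ys" if "i < length ys" for i
    using assms(4) that by (metis lessThan_iff nth_mem subsetD)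
  then show ?thesis
    using assms(1-3) by (auto simp: realizes_def)
qed

lemma cut_state_perms3: "fst (cut_state n S) \<in> perms3"
proof (induction n)
  case 0
  then show ?case by (simp add: perms3_def turn_def)
next
  case (Suc n)
  obtain ys d where "claw_reduce (fst (cut_state n S))
      (Root n \<in> S) (Mid n 0 \<in> S) (Mid n 1 \<in> S) (Mid n 2 \<in> S) = (ys, d)"
    by fastforce
  then show ?case
    using claw_reduce_ports[OF Suc, of "Root n \<in> S" "Mid n 0 \<in> S" "Mid n 1 \<in> S" "Mid n 2 \<in> S"]
    by (simp add: case_prod_beta)
qed

lemma attach_claw_permutes: "attach_claw n S permutes ports (Suc n) \<union> ports n \<union> claw_darts n"
  using realizes_permutes[OF realizes_attach_claw] claw_word_perm by (simp add: claw_dart_image)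

lemma base_perm_permutes: "base_perm S permutes darts 0"
proof (rule bij_imp_permutes)
  have "inj_on (base_perm S) (darts 0)"
    by (cases "Base \<in> S") (auto simp: inj_on_def darts_def base_perm_def turn_def less_3_iff)
  moreover have "base_perm S ` darts 0 \<subseteq> darts 0"
    by (auto simp: darts_def base_perm_def)
  ultimately show "bij_betw (base_perm S) (darts 0) (darts 0)"
    by (simp add: bij_betw_def endo_inj_surj finite_darts)
qed (auto simp: darts_def base_perm_def split: dart.splits)

lemma cut_perm_permutes: "cut_perm n S permutes darts n"
proof (induction n)
  case 0
  then show ?case by (simp add: base_perm_permutes)
next
  case (Suc n)
  have "ports n \<subseteq> darts n"
    by (auto simp: ports_def darts_def)
  then show ?case
    unfolding cut_perm.simps darts_Suc
    by (intro permutes_compose permutes_subset[OF Suc] permutes_subset[OF attach_claw_permutes]) auto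
qed

text \<open>A strand entering at port \<open>j\<close> turns once at \<open>Base\<close> and returns
  along an \<open>Up\<close> dart. Removing the \<open>Up\<close> darts leaves the turn itself and
  closes no face.\<close>

lemma num_orbits_base:
  assumes "finite C" "C \<inter> darts 0 = {}" "\<kappa> permutes ports 0 \<union> C"
  shows "num_orbits (\<kappa> \<circ> base_perm S) (darts 0 \<union> C)
    = num_orbits (\<kappa> \<circ> port_perm 0 (map (turn (Base \<in> S)) [0, 1, 2])) (ports 0 \<union> C)"
proof -
  define e where "e i = (if i < 3 then Down 0 i else Up 0 (i - 3))" for i
  let ?t = "turn (Base \<in> S)"
  let ?xs = "map (\<lambda>j. 3 + ?t j) [0, 1, 2] @ [0, 1, 2]"
  let ?ys = "map ?t [0, 1, 2] @ [3, 4, 5]"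
  have 6: "{..<6} = {0, 1, 2, 3, 4, 5 :: nat}" by auto
  have img: "e ` {..<6} = darts 0" "e ` set [3, 4, 5] = Up 0 ` {..<3}"
    by (simp_all add: 6 e_def darts_0 ports_def lessThan_3)
  have inj: "inj_on e {..<6}"
    by (auto simp: inj_on_def e_def split: if_splits)
  have realizes_e: "realizes e xs g \<longleftrightarrow> (\<forall>i \<in> {0, 1, 2, 3, 4, 5}. g (e i) = e (xs ! i))
      \<and> (\<forall>d. d \<notin> darts 0 \<longrightarrow> g d = d)" if "length xs = 6" for xs g
    unfolding realizes_def that img by (simp only: lessThan_iff flip: 6) blast
  have xs: "realizes e ?xs (base_perm S)"
    by (subst realizes_e) (auto simp: e_def base_perm_def darts_def split: dart.splits)
  have red: "reduce [3, 4, 5] ?xs = (?ys, 0)"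
    by (cases "Base \<in> S") (simp_all add: turn_def skip_list_def)
  have diff: "darts 0 \<union> C - e ` set [3, 4, 5] = ports 0 \<union> C"
    using assms(2) unfolding img darts_0 by (auto simp: ports_def)
  have "\<exists>h. realizes e ?ys h \<and> num_orbits (\<kappa> \<circ> base_perm S) (darts 0 \<union> C)
      = 0 + num_orbits (\<kappa> \<circ> h) (darts 0 \<union> C - e ` set [3, 4, 5])"
  proof (rule num_orbits_reduce[OF _ _ _ xs _ _ _ _ _ red])
    show "base_perm S permutes darts 0 \<union> C"
      by (rule permutes_subset[OF base_perm_permutes]) auto
    show "e ` set [3, 4, 5] \<subseteq> darts 0 \<union> C"
      unfolding img darts_0 by auto
    show "inj_on e {..<length ?xs}"
      using inj by (simp add: eval_nat_numeral)
    show "set ?xs \<subseteq> {..<length ?xs}"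
      by (cases "Base \<in> S") (simp_all add: turn_def)
    show "\<kappa> permutes darts 0 \<union> C - e ` set [3, 4, 5]"
      unfolding diff by (rule assms)
  qed (use assms finite_darts[of 0] in auto)
  then obtain h where h: "realizes e ?ys h"
      "num_orbits (\<kappa> \<circ> base_perm S) (darts 0 \<union> C) = num_orbits (\<kappa> \<circ> h) (ports 0 \<union> C)"
    unfolding diff by auto
  have "realizes e ?ys (port_perm 0 (map ?t [0, 1, 2]))"
    by (subst realizes_e; cases "Base \<in> S")
       (auto simp: e_def port_perm_def darts_def turn_def split: dart.splits)
  then show ?thesis
    using h realizes_unique by metis
qed

text \<open>Seen from outside, the cut graph can be replaced by its \<open>cut_state\<close>,
  whatever \<open>\<kappa>\<close> does at the ports and on further darts \<open>C\<close>. The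
  induction rests on this freedom in \<open>\<kappa>\<close> and \<open>C\<close>.\<close>

lemma num_orbits_cut_perm:
  assumes "finite C" "C \<inter> darts n = {}" "\<kappa> permutes ports n \<union> C"
  shows "num_orbits (\<kappa> \<circ> cut_perm n S) (darts n \<union> C)
    = snd (cut_state n S) + num_orbits (\<kappa> \<circ> port_perm n (fst (cut_state n S))) (ports n \<union> C)"
  using assms
proof (induction n arbitrary: \<kappa> C)
  case 0
  then show ?case
    using num_orbits_base[OF 0, of S]
    by (simp only: cut_perm.simps cut_state.simps fst_conv snd_conv add_0)
next
  case (Suc n)
  obtain p f where pf: "cut_state n S = (p, f)" by fastforce
  have p: "p \<in> perms3"
    using cut_state_perms3[of n S] pf by simp
  let ?w = "claw_word (Root n \<in> S) (Mid n 0 \<in> S) (Mid n 1 \<in> S) (Mid n 2 \<in> S)"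
  let ?xs = "map ((!) ?w) (port_word p)"
  let ?g = "attach_claw n S \<circ> port_perm n p"
  obtain ys d where ys: "reduce [3, 4, 5, 6, 7, 8, 9, 10, 11, 12, 13, 14] ?xs = (ys, d)" by fastforce
  then have cr: "claw_reduce p (Root n \<in> S) (Mid n 0 \<in> S) (Mid n 1 \<in> S) (Mid n 2 \<in> S) = (ys, d)"
    by (simp add: claw_reduce_def)
  have q: "take 3 ys \<in> perms3" "drop 3 ys = [3, 4, 5, 6, 7, 8, 9, 10, 11, 12, 13, 14]"
    using claw_reduce_ports[OF p, of "Root n \<in> S" "Mid n 0 \<in> S" "Mid n 1 \<in> S" "Mid n 2 \<in> S"]
    unfolding cr by simp_all
  have state: "cut_state (Suc n) S = (take 3 ys, f + d)"
    by (simp only: cut_state.simps pf cr prod.case)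
  let ?C = "C \<union> ports (Suc n) \<union> claw_darts n"
  have subset: "ports n \<subseteq> darts n" "ports (Suc n) \<inter> darts n = {}" "claw_darts n \<inter> darts n = {}"
      "ports (Suc n) \<inter> claw_darts n = {}"
    by (auto simp: ports_def darts_def claw_darts_def)
  have fin: "finite ?C" "finite (ports n)"
    using Suc.prems(1) by (auto simp: ports_def claw_darts_def)
  have disj: "?C \<inter> darts n = {}"
    using Suc.prems(2) subset by (auto simp: darts_Suc)
  \<comment> \<open>The claw moves to the outside: its map is absorbed into \<open>\<kappa>\<close>
    and its darts into \<open>?C\<close>, so the induction hypothesis concerns the smaller graph
    only.\<close>
  have "\<kappa> \<circ> attach_claw n S permutes ports n \<union> ?C"
    by (intro permutes_compose permutes_subset[OF Suc.prems(3)]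
          permutes_subset[OF attach_claw_permutes]) auto
  then have "num_orbits (\<kappa> \<circ> attach_claw n S \<circ> cut_perm n S) (darts n \<union> ?C)
      = f + num_orbits (\<kappa> \<circ> attach_claw n S \<circ> port_perm n p) (ports n \<union> ?C)"
    using Suc.IH[OF fin(1) disj] by (simp only: pf fst_conv snd_conv)
  moreover have "darts n \<union> ?C = darts (Suc n) \<union> C"
    by (auto simp: darts_Suc)
  ultimately have 1: "num_orbits (\<kappa> \<circ> cut_perm (Suc n) S) (darts (Suc n) \<union> C)
      = f + num_orbits (\<kappa> \<circ> ?g) (ports n \<union> ?C)"
    by (simp add: comp_assoc)
  have g: "realizes (claw_dart n) ?xs ?g"
    using realizes_comp[OF realizes_attach_claw realizes_port_perm[OF p]]
    by (simp add: claw_word_perm port_word_perm[OF p])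
  have img: "claw_dart n ` set [3, 4, 5, 6, 7, 8, 9, 10, 11, 12, 13, 14] = ports n \<union> claw_darts n"
    by (rule claw_dart_image_skipped)
  have diff: "ports n \<union> ?C - (ports n \<union> claw_darts n) = ports (Suc n) \<union> C"
    using subset Suc.prems(2) by (auto simp: darts_Suc ports_def)
  have "port_perm n p permutes claw_dart n ` {..<15}"
    using realizes_permutes[OF realizes_port_perm[OF p]] port_word_perm[OF p] by simp
  then have gp: "?g permutes ports n \<union> ?C"
    unfolding claw_dart_image
    by (intro permutes_compose permutes_subset[OF attach_claw_permutes]) (auto elim: permutes_subset)
  have xs: "set ?xs \<subseteq> {..<length ?xs}" "length ?xs = 15"
    using port_word_perm[OF p] claw_word_perm by (auto simp: subset_iff) (metis lessThan_iff nth_mem)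
  \<comment> \<open>Of the fifteen explicit darts only the new ports survive; \<open>d\<close>
    counts the faces closed by the claw.\<close>
  obtain h where h: "realizes (claw_dart n) ys h"
      "num_orbits (\<kappa> \<circ> ?g) (ports n \<union> ?C) = d + num_orbits (\<kappa> \<circ> h) (ports (Suc n) \<union> C)"
    using num_orbits_reduce[OF _ gp _ g _ xs(1) _ _ _ ys, of \<kappa>] fin Suc.prems(3) inj_claw_dart[of n]
    unfolding img diff xs by auto
  have "realizes (claw_dart n) ys (port_perm (Suc n) (take 3 ys))"
  proof -
    obtain a b c where abc: "take 3 ys = [a, b, c]" "a < 3" "b < 3" "c < 3"
      using q(1) by (auto simp: perms3_def)
    then have ys_eq: "ys = [a, b, c, 3, 4, 5, 6, 7, 8, 9, 10, 11, 12, 13, 14]"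
      using q(2) append_take_drop_id[of 3 ys] by simp
    have len: "length ys = 15"
      by (simp add: ys_eq)
    have "port_perm (Suc n) [a, b, c] (claw_dart n i) = claw_dart n (ys ! i)" if "i < 15" for i
    proof -
      have "i \<in> {..<15}"
        using that by simp
      then show ?thesis
        using abc(2-) unfolding lessThan_15 insert_iff empty_iff ys_eq
        by (elim disjE FalseE; simp add: claw_dart_def port_perm_def)
    qed
    moreover have "port_perm (Suc n) [a, b, c] d = d" if "d \<notin> claw_dart n ` {..<15}" for d
      using that unfolding claw_dart_image
      by (auto simp: ports_def port_perm_def split: dart.splits)
    ultimately show ?thesis
      unfolding realizes_def abc(1) len by blast
  qed
  then show ?case
    using 1 h realizes_unique by (metis add.assoc fst_conv snd_conv state)
qed

section \<open>Counting rotation systems by strand permutation\<close>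

text \<open>The open root is left out. The form by insertions lets a sum over subsets split off one
  orientation at a time.\<close>

primrec lower_verts :: "nat \<Rightarrow> claw_vertex set" where
  "lower_verts 0 = {Base}"
| "lower_verts (Suc n) =
     insert (Root n) (insert (Mid n 0) (insert (Mid n 1) (insert (Mid n 2) (lower_verts n))))"

lemma claw_verts_eq: "claw_verts n = insert (Root n) (lower_verts n)"
proof (induction n)
  case (Suc n)
  have "{Mid n j | j. j < 3} = {Mid n 0, Mid n 1, Mid n 2}"
    by (auto simp: less_3_iff)
  with Suc show ?case by auto
qed auto

lemma finite_lower_verts: "finite (lower_verts n)"
  by (induction n) auto

lemma lower_verts_bounds:
  "Root m \<in> lower_verts n \<longleftrightarrow> m < n" "Mid m j \<in> lower_verts n \<longleftrightarrow> m < n \<and> j < 3"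
  "Base \<in> lower_verts n"
  by (induction n) (auto simp: less_3_iff)

lemma sum_Pow_insert:
  assumes "finite A" "x \<notin> A"
  shows "(\<Sum>S\<in>Pow (insert x A). h S) = (\<Sum>S\<in>Pow A. \<Sum>b\<in>UNIV. h (if b then insert x S else S))"
proof -
  have "inj_on (insert x) (Pow A)"
    using assms(2) by (intro inj_onI) (metis Diff_insert_absorb PowD insert_subset subsetD)
  moreover have "Pow A \<inter> insert x ` Pow A = {}"
    using assms(2) by auto
  ultimately have "(\<Sum>S\<in>Pow (insert x A). h S) = (\<Sum>S\<in>Pow A. h S) + (\<Sum>S\<in>Pow A. h (insert x S))"
    using assms(1) by (simp add: Pow_insert sum.union_disjoint sum.reindex)
  also have "\<dots> = (\<Sum>S\<in>Pow A. h (insert x S) + h S)"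
    by (simp add: sum.distrib add.commute)
  finally show ?thesis
    by (simp add: UNIV_bool add.commute)
qed

text \<open>The state reads only orientations below the open root, so those of the four vertices
  absorbed next are independent of it.\<close>

lemma cut_state_cong: "S \<inter> lower_verts n = S' \<inter> lower_verts n \<Longrightarrow> cut_state n S = cut_state n S'"
proof (induction n)
  case 0
  then have "Base \<in> S \<longleftrightarrow> Base \<in> S'"
    unfolding lower_verts.simps by blast
  then show ?case by (simp only: cut_state.simps)
next
  case (Suc n)
  have "cut_state n S = cut_state n S'"
    using Suc.prems by (intro Suc.IH) auto
  moreover have "Root n \<in> S \<longleftrightarrow> Root n \<in> S'" "Mid n 0 \<in> S \<longleftrightarrow> Mid n 0 \<in> S'"
      "Mid n 1 \<in> S \<longleftrightarrow> Mid n 1 \<in> S'" "Mid n 2 \<in> S \<longleftrightarrow> Mid n 2 \<in> S'"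
    using Suc.prems unfolding lower_verts.simps by blast+
  ultimately show ?case by (simp only: cut_state.simps)
qed

text \<open>The joint distribution of class and closed faces over all rotations of the cut graph,
  kept as a functional of \<open>h\<close> so that a new claw simply acts on
  \<open>h\<close>.\<close>

definition state_sum :: "nat \<Rightarrow> (nat \<Rightarrow> nat \<Rightarrow> nat) \<Rightarrow> nat" where
  "state_sum n h = (\<Sum>S\<in>Pow (lower_verts n). h (perm_class (fst (cut_state n S))) (snd (cut_state n S)))"

lemma state_sum_0: "state_sum 0 h = 2 * h 2 0"
proof -
  have "perm_class (map (turn b) [0, 1, 2]) = 2" for b
    by (cases b) (simp_all add: perm_class_def turn_def)
  then show ?thesis
    unfolding state_sum_def lower_verts.simps
    by (subst sum_Pow_insert) (simp_all add: UNIV_bool)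
qed

lemma state_sum_Suc: "state_sum (Suc n) h = state_sum n (class_sum h)"
proof -
  let ?g = "\<lambda>p f r m0 m1 m2. h (perm_class (take 3 (fst (claw_reduce p r m0 m1 m2))))
    (f + snd (claw_reduce p r m0 m1 m2))"
  \<comment> \<open>Splitting off the vertices leaves \<open>Root n\<close> innermost, whereas
    \<open>sum_claw_reduce\<close> has it outermost.\<close>
  have swap: "(\<Sum>m2\<in>UNIV. \<Sum>m1\<in>UNIV. \<Sum>m0\<in>UNIV. \<Sum>r\<in>UNIV. G r m0 m1 m2)
      = (\<Sum>r\<in>UNIV. \<Sum>m0\<in>UNIV. \<Sum>m1\<in>UNIV. \<Sum>m2\<in>UNIV. G r m0 m1 m2)"
    for G :: "bool \<Rightarrow> bool \<Rightarrow> bool \<Rightarrow> bool \<Rightarrow> nat"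
    by (simp add: UNIV_bool)
  have key: "?g (fst (cut_state n S')) (snd (cut_state n S'))
        (Root n \<in> S') (Mid n 0 \<in> S') (Mid n 1 \<in> S') (Mid n 2 \<in> S')
      = ?g (fst (cut_state n S)) (snd (cut_state n S)) r m0 m1 m2"
    if "S \<in> Pow (lower_verts n)" and S': "Z = (if m2 then insert (Mid n 2) S else S)"
      "Y = (if m1 then insert (Mid n 1) Z else Z)" "X = (if m0 then insert (Mid n 0) Y else Y)"
      "S' = (if r then insert (Root n) X else X)"
    for S S' X Y Z r m0 m1 m2
  proof -
    have notin: "Root n \<notin> S" "Mid n j \<notin> S" for j
      using that(1) lower_verts_bounds by blast+
    have "cut_state n S' = cut_state n S"
      unfolding S' by (rule cut_state_cong) (auto simp: lower_verts_bounds)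
    moreover have "Root n \<in> S' \<longleftrightarrow> r" "Mid n 0 \<in> S' \<longleftrightarrow> m0" "Mid n 1 \<in> S' \<longleftrightarrow> m1" "Mid n 2 \<in> S' \<longleftrightarrow> m2"
      using notin by (auto simp: S')
    ultimately show ?thesis by (simp only:)
  qed
  have "state_sum (Suc n) h = (\<Sum>S\<in>Pow (lower_verts (Suc n)).
      ?g (fst (cut_state n S)) (snd (cut_state n S))
        (Root n \<in> S) (Mid n 0 \<in> S) (Mid n 1 \<in> S) (Mid n 2 \<in> S))"
    by (simp add: state_sum_def case_prod_beta)
  also have "\<dots> = (\<Sum>S\<in>Pow (lower_verts n). \<Sum>m2\<in>UNIV. \<Sum>m1\<in>UNIV. \<Sum>m0\<in>UNIV. \<Sum>r\<in>UNIV.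
      ?g (fst (cut_state n S)) (snd (cut_state n S)) r m0 m1 m2)"
    unfolding lower_verts.simps
    apply (subst sum_Pow_insert, simp add: finite_lower_verts, simp add: lower_verts_bounds)+
    apply (intro sum.cong refl)
    apply (rule key[OF _ refl refl refl refl], assumption)
    done
  also have "\<dots> = (\<Sum>S\<in>Pow (lower_verts n). \<Sum>r\<in>UNIV. \<Sum>m0\<in>UNIV. \<Sum>m1\<in>UNIV. \<Sum>m2\<in>UNIV.
      ?g (fst (cut_state n S)) (snd (cut_state n S)) r m0 m1 m2)"
    by (intro sum.cong refl swap)
  also have "\<dots> = state_sum n (class_sum h)"
    unfolding state_sum_def sum_claw_reduce[OF cut_state_perms3] ..
  finally show ?thesis .
qed

section \<open>Closing up the root\<close>

definition full_perm :: "nat \<Rightarrow> claw_vertex set \<Rightarrow> dart \<Rightarrow> dart" where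
  "full_perm n S = port_perm n (map (turn (Root n \<in> S)) [0, 1, 2]) \<circ> cut_perm n S"

lemma realizes_ports: "length p = 3 \<Longrightarrow> realizes (Down n) p (port_perm n p)"
  by (auto simp: realizes_def port_perm_def split: dart.splits)

lemma port_perm_permutes:
  assumes "p \<in> perms3"
  shows "port_perm n p permutes ports n"
proof -
  have "length p = 3" "distinct p" "set p \<subseteq> {..<length p}"
    using assms by (auto simp: perms3_def)
  then show ?thesis
    using realizes_permutes[OF realizes_ports] by (metis ports_def)
qed

lemma full_perm_permutes: "full_perm n S permutes darts n"
proof -
  have "map (turn (Root n \<in> S)) [0, 1, 2] \<in> perms3"
    by (simp add: perms3_def turn_def)
  moreover have "ports n \<subseteq> darts n"
    by (auto simp: ports_def darts_def)
  ultimately show ?thesis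
    unfolding full_perm_def
    by (meson cut_perm_permutes permutes_compose permutes_subset port_perm_permutes)
qed

lemma num_orbits_full_perm:
  "num_orbits (full_perm n S) (darts n)
     = snd (cut_state n S) + snd (turn_reduce (Root n \<in> S) (fst (cut_state n S)))"
proof -
  let ?t = "map (turn (Root n \<in> S)) [0, 1, 2]"
  obtain p f where pf: "cut_state n S = (p, f)" by fastforce
  have p: "p \<in> perms3"
    using cut_state_perms3[of n S] pf by simp
  have t: "?t \<in> perms3"
    by (simp add: perms3_def turn_def)
  let ?xs = "map (turn (Root n \<in> S)) p"
  obtain ys d where red: "reduce [0, 1, 2] ?xs = (ys, d)" by fastforce
  have "map ((!) ?t) p = ?xs"
    using p by (auto simp: perms3_def)
  then have xs: "realizes (Down n) ?xs (port_perm n ?t \<circ> port_perm n p)"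
    using realizes_comp[OF realizes_ports[of ?t n] realizes_ports[of p n]] p
    by (auto simp: perms3_def)
  have [simp]: "length p = 3"
    using p by (auto simp: perms3_def)
  have img: "Down n ` set [0, 1, 2] = ports n"
    by (simp add: ports_def lessThan_3)
  \<comment> \<open>With \<open>id\<close> as outside permutation and all three ports removed
    nothing is left, so \<open>d\<close> counts every orbit.\<close>
  have "\<exists>h. realizes (Down n) ys h \<and> num_orbits (id \<circ> (port_perm n ?t \<circ> port_perm n p)) (ports n)
      = d + num_orbits (id \<circ> h) (ports n - Down n ` set [0, 1, 2])"
  proof (rule num_orbits_reduce[OF _ _ _ xs _ _ _ _ _ red])
    show "port_perm n ?t \<circ> port_perm n p permutes ports n"
      using p t by (intro permutes_compose port_perm_permutes)
    show "finite (ports n)" by (simp add: ports_def)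
  qed (use p in \<open>auto simp: img permutes_id inj_on_def ports_def perms3_def\<close>)
  then have "num_orbits (port_perm n ?t \<circ> port_perm n p) (ports n) = d"
    unfolding img by (auto simp: num_orbits_def)
  moreover have "num_orbits (full_perm n S) (darts n)
      = f + num_orbits (port_perm n ?t \<circ> port_perm n p) (ports n)"
    using num_orbits_cut_perm[of "{}" n "port_perm n ?t" S] port_perm_permutes[OF t]
    by (simp only: full_perm_def pf finite.emptyI Int_empty_left Un_empty_right fst_conv snd_conv)
  ultimately show ?thesis
    by (simp only: pf turn_reduce_def red fst_conv snd_conv)
qed

lemma sum_turn_reduce:
  fixes h :: "nat \<Rightarrow> nat"
  assumes "p \<in> perms3"
  shows "(\<Sum>r\<in>UNIV. h (f + snd (turn_reduce r p)))
    = (if perm_class p = 0 then 2 * h (f + 1) else if perm_class p = 1 then 2 * h (f + 2)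
        else h (f + 3) + h (f + 1))"
  unfolding UNIV_bool turn_reduce_count[OF assms]
  by (cases "perm_class p = 0"; cases "perm_class p = 1"; cases "p = [2, 0, 1]"; simp)

lemma sum_full_perm:
  "(\<Sum>S\<in>Pow (claw_verts n). h (num_orbits (full_perm n S) (darts n)))
    = state_sum n (\<lambda>k f. if k = 0 then 2 * h (f + 1) else if k = 1 then 2 * h (f + 2)
        else h (f + 3) + h (f + 1))"
proof -
  have key: "h (snd (cut_state n S') + snd (turn_reduce (Root n \<in> S') (fst (cut_state n S'))))
      = h (snd (cut_state n S) + snd (turn_reduce r (fst (cut_state n S))))"
    if "S \<in> Pow (lower_verts n)" and S': "S' = (if r then insert (Root n) S else S)" for S S' r
  proof -
    have "cut_state n S' = cut_state n S"
      unfolding S' by (rule cut_state_cong) (auto simp: lower_verts_bounds)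
    moreover have "Root n \<in> S' \<longleftrightarrow> r"
      using that lower_verts_bounds(1)[of n n] by auto
    ultimately show ?thesis by (simp only:)
  qed
  have "(\<Sum>S\<in>Pow (claw_verts n). h (num_orbits (full_perm n S) (darts n)))
    = (\<Sum>S\<in>Pow (lower_verts n). \<Sum>r\<in>UNIV.
         h (snd (cut_state n S) + snd (turn_reduce r (fst (cut_state n S)))))"
    unfolding claw_verts_eq num_orbits_full_perm
    apply (subst sum_Pow_insert, simp add: finite_lower_verts, simp add: lower_verts_bounds)
    apply (intro sum.cong refl)
    apply (rule key[OF _ refl], assumption)
    done
  then show ?thesis
    unfolding state_sum_def sum_turn_reduce[OF cut_state_perms3] .
qed

section \<open>Rotation systems of cubic graphs\<close>

lemma cyclic_on_3_iff:
  assumes "a \<noteq> b" "b \<noteq> c" "a \<noteq> c"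
  shows "cyclic_on f {a, b, c} \<longleftrightarrow> f a = b \<and> f b = c \<and> f c = a \<or> f a = c \<and> f c = b \<and> f b = a"
proof
  assume cyc: "cyclic_on f {a, b, c}"
  \<comment> \<open>The case \<open>x = y\<close> excludes fixed points, the rest 2-cycles; either
    would trap the orbit in fewer than three points.\<close>
  have no2: "\<not> (f x = y \<and> f y = x)" if "x \<in> {a, b, c}" for x y
  proof
    assume xy: "f x = y \<and> f y = x"
    have "z \<in> {x, y}" if "z \<in> orbit f x" for z
      using that by induction (use xy in auto)
    moreover have "orbit f x = {a, b, c}"
      using cyc that unfolding cyclic_on_alldef by metis
    ultimately have "{a, b, c} \<subseteq> {x, y}"
      by blast
    then show False
      using assms by blast
  qed
  have "f x \<in> {a, b, c}" if "x \<in> {a, b, c}" for x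
    using cyc that orbit.base[of f x] unfolding cyclic_on_alldef by metis
  then show "f a = b \<and> f b = c \<and> f c = a \<or> f a = c \<and> f c = b \<and> f b = a"
    using no2[of a] no2[of b] no2[of c] by blast
next
  have "cyclic_on f {x, y, z}" if "f x = y" "f y = z" "f z = x" for x y z
  proof -
    have "u \<in> {x, y, z}" if "u \<in> orbit f x" for u
      using that by induction (use \<open>f x = y\<close> \<open>f y = z\<close> \<open>f z = x\<close> in auto)
    moreover have "{x, y, z} \<subseteq> orbit f x"
      using orbit.base[of f x] orbit.step[of y f x] orbit.step[of z f x] that by auto
    ultimately show ?thesis
      by (auto simp: cyclic_on_def)
  qed
  moreover assume "f a = b \<and> f b = c \<and> f c = a \<or> f a = c \<and> f c = b \<and> f b = a"
  moreover have "{a, c, b} = {a, b, c}" by auto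
  ultimately show "cyclic_on f {a, b, c}" by metis
qed

definition cubic_rotation :: "('a, 'b) pre_digraph \<Rightarrow> ('a \<Rightarrow> nat \<Rightarrow> 'b) \<Rightarrow> 'a set \<Rightarrow> 'b \<Rightarrow> 'b" where
  "cubic_rotation G out S a =
     (if a \<in> arcs G
      then out (tail G a) (turn (tail G a \<in> S) (the_inv_into {..<3} (out (tail G a)) a))
      else a)"

locale cubic_digraph = wf_digraph G for G :: "('a, 'b) pre_digraph" +
  fixes out :: "'a \<Rightarrow> nat \<Rightarrow> 'b"
  assumes bij_out: "v \<in> verts G \<Longrightarrow> bij_betw (out v) {..<3} (out_arcs G v)"
begin

lemma out_arc:
  assumes "v \<in> verts G" "k < 3"
  shows "out v k \<in> arcs G" "tail G (out v k) = v"
  using bij_betwE[OF bij_out[OF assms(1)]] assms(2) by auto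

lemma arc_eq_out:
  assumes "a \<in> arcs G"
  obtains v k where "v \<in> verts G" "k < 3" "a = out v k"
proof -
  have v: "tail G a \<in> verts G" "a \<in> out_arcs G (tail G a)"
    using assms by auto
  then have "a \<in> out (tail G a) ` {..<3}"
    using bij_out by (simp add: bij_betw_def)
  then obtain k where "k < 3" "a = out (tail G a) k" by blast
  with v(1) show ?thesis by (rule that)
qed

lemma out_eq_iff:
  assumes "v \<in> verts G" "k < 3" "l < 3"
  shows "out v k = out v l \<longleftrightarrow> k = l"
  using bij_out[OF assms(1)] assms(2,3) by (auto simp: bij_betw_def inj_on_def)

lemma cubic_rotation_out:
  assumes "v \<in> verts G" "k < 3"
  shows "cubic_rotation G out S (out v k) = out v (turn (v \<in> S) k)"
  using assms bij_out[OF assms(1)]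
  by (simp add: cubic_rotation_def out_arc the_inv_into_f_f bij_betw_def)

lemma out_arcs_eq: "v \<in> verts G \<Longrightarrow> out_arcs G v = {out v 0, out v 1, out v 2}"
  using bij_out[of v] by (simp add: bij_betw_def lessThan_3)

lemma rotation_system_cubic_rotation: "rotation_system G (cubic_rotation G out S)"
  unfolding rotation_system_def
proof (intro conjI ballI impI)
  \<comment> \<open>Reversing the orientation of every vertex inverts the rotation.\<close>
  have inv: "cubic_rotation G out (- T) (cubic_rotation G out T a) = a" if a: "a \<in> arcs G" for T a
  proof -
    obtain v k where vk: "v \<in> verts G" "k < 3" "a = out v k"
      using a by (rule arc_eq_out)
    have "turn (v \<in> - T) (turn (v \<in> T) k) = k"
      using vk(2) unfolding less_3_iff by (auto simp: turn_def)
    then show ?thesis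
      using vk by (simp add: cubic_rotation_out)
  qed
  have closed: "cubic_rotation G out T ` arcs G \<subseteq> arcs G" for T
    by (auto elim!: arc_eq_out simp: cubic_rotation_out out_arc)
  have "bij_betw (cubic_rotation G out S) (arcs G) (arcs G)"
    using inv[of _ S] inv[of _ "- S"] closed
    by (intro bij_betw_byWitness[where f' = "cubic_rotation G out (- S)"]) auto
  then show "cubic_rotation G out S permutes arcs G"
    by (rule bij_imp_permutes) (simp add: cubic_rotation_def)
  fix v assume v: "v \<in> verts G"
  show "cyclic_on (cubic_rotation G out S) (out_arcs G v)"
    unfolding out_arcs_eq[OF v]
    by (subst cyclic_on_3_iff) (simp_all add: out_eq_iff v cubic_rotation_out, simp add: turn_def)
qed

text \<open>Three arcs admit two cyclic orders, and whether \<open>out v 0\<close> is followed by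
  \<open>out v 1\<close> tells them apart.\<close>

lemma bij_cubic_rotation:
  "bij_betw (cubic_rotation G out) (Pow (verts G)) {\<rho>. rotation_system G \<rho>}"
proof (rule bij_betwI')
  fix S T assume "S \<in> Pow (verts G)" "T \<in> Pow (verts G)"
  moreover have "v \<in> S \<longleftrightarrow> cubic_rotation G out S (out v 0) = out v 1" if "v \<in> verts G" for S v
    using that by (simp add: cubic_rotation_out out_eq_iff) (simp add: turn_def)
  ultimately show "(cubic_rotation G out S = cubic_rotation G out T) = (S = T)"
    by (metis PowD subsetD subsetI subset_antisym)
next
  fix \<rho> assume "\<rho> \<in> {\<rho>. rotation_system G \<rho>}"
  then have perm: "\<rho> permutes arcs G"
    and cyc: "\<And>v. v \<in> verts G \<Longrightarrow> cyclic_on \<rho> {out v 0, out v 1, out v 2}"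
    by (auto simp: rotation_system_def out_arcs_eq)
  define S where "S = {v \<in> verts G. \<rho> (out v 0) = out v 1}"
  have "\<rho> a = cubic_rotation G out S a" for a
  proof (cases "a \<in> arcs G")
    case True
    then obtain v k where vk: "v \<in> verts G" "k < 3" "a = out v k"
      by (rule arc_eq_out)
    have "out v 0 \<noteq> out v 1" "out v 1 \<noteq> out v 2" "out v 0 \<noteq> out v 2"
      using vk(1) by (simp_all add: out_eq_iff)
    then have "\<rho> a = out v (turn (v \<in> S) k)"
      using cyc[OF vk(1)] vk unfolding less_3_iff
      by (subst (asm) cyclic_on_3_iff) (auto simp: S_def turn_def numeral_2_eq_2)
    then show ?thesis
      using vk by (simp add: cubic_rotation_out)
  next
    case False
    then show ?thesis
      using perm by (simp add: permutes_not_in cubic_rotation_def)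
  qed
  then have "\<rho> = cubic_rotation G out S"
    by (rule ext)
  moreover have "S \<in> Pow (verts G)"
    unfolding S_def by blast
  ultimately show "\<exists>S \<in> Pow (verts G). \<rho> = cubic_rotation G out S"
    by blast
qed (simp add: rotation_system_cubic_rotation)

end

section \<open>The faces of an iterated claw\<close>

fun dart_rev :: "dart \<Rightarrow> dart" where
  "dart_rev (Down l j) = Up l j"
| "dart_rev (Up l j) = Down l j"
| "dart_rev (Out l j) = In l j"
| "dart_rev (In l j) = Out l j"

fun dart_src :: "nat \<Rightarrow> dart \<Rightarrow> claw_vertex" where
  "dart_src n (Down l j) = (if l = n then Root n else Mid l j)"
| "dart_src n (Up l j) = (case l of 0 \<Rightarrow> Base | Suc m \<Rightarrow> Mid m j)"
| "dart_src n (Out l j) = Root l"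
| "dart_src n (In l j) = Mid l j"

fun dart_label :: "dart \<Rightarrow> nat" where
  "dart_label (Down l j) = j"
| "dart_label (Up l j) = j"
| "dart_label (Out l j) = j"
| "dart_label (In l j) = j"

definition dart_arc :: "nat \<Rightarrow> dart \<Rightarrow> claw_arc" where
  "dart_arc n d = (dart_src n d, dart_label d, dart_src n (dart_rev d))"

text \<open>The order \<open>Down\<close>, \<open>In\<close>, \<open>Up\<close> at
  \<open>Mid l j\<close> is the one that \<open>attach_claw\<close> uses for vertices in
  \<open>S\<close>.\<close>

fun vertex_dart :: "nat \<Rightarrow> claw_vertex \<Rightarrow> nat \<Rightarrow> dart" where
  "vertex_dart n Base k = Up 0 k"
| "vertex_dart n (Root l) k = (if l = n then Down n k else Out l k)"
| "vertex_dart n (Mid l j) k = [Down l j, In l j, Up (Suc l) j] ! k"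

lemma dart_rev_in_darts: "d \<in> darts n \<Longrightarrow> dart_rev d \<in> darts n"
  by (auto simp: darts_def)

lemma dart_rev_eq_iff: "dart_rev x = y \<longleftrightarrow> x = dart_rev y"
  by (cases x; cases y) auto

lemma rev_dart_arc: "rev_arc (dart_arc n d) = dart_arc n (dart_rev d)"
  by (cases d) (simp_all add: rev_arc_def dart_arc_def)

lemma inj_dart_arc: "inj_on (dart_arc n) (darts n)"
  by (auto simp: inj_on_def dart_arc_def darts_def split: if_splits nat.splits)

lemma claw_edges_eq:
  "claw_edges n = dart_arc n ` ({Down l j | l j. l \<le> n \<and> j < 3} \<union> {Out l j | l j. l < n \<and> j < 3})"
proof (induction n)
  case 0
  have "{Down l j | l j. l \<le> 0 \<and> j < 3} \<union> {Out l j | l j. l < 0 \<and> j < 3} = Down 0 ` {..<3}"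
    by auto
  then show ?case by (auto simp: dart_arc_def image_image)
next
  case (Suc n)
  let ?E = "\<lambda>n. {Down l j | l j. l \<le> n \<and> j < 3} \<union> {Out l j | l j. l < n \<and> j < 3}"
  have root: "(Root n, j, y) \<in> claw_edges n \<longleftrightarrow> j < 3 \<and> y = (case n of 0 \<Rightarrow> Base | Suc m \<Rightarrow> Mid m j)" for j y
    using claw_edges_at_root[of n] by force
  let ?L = "{Down l j | l j. l < n \<and> j < 3} \<union> {Out l j | l j. l < n \<and> j < 3}"
  have "{(x, j, y) \<in> claw_edges n. x \<noteq> Root n} = dart_arc n ` {d \<in> ?E n. dart_src n d \<noteq> Root n}"
    unfolding Suc by (auto simp: dart_arc_def)
  also have "{d \<in> ?E n. dart_src n d \<noteq> Root n} = ?L"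
    by auto
  also have "dart_arc n ` ?L = dart_arc (Suc n) ` ?L"
    by (intro image_cong) (auto simp: dart_arc_def)
  finally have "{(x, j, y) \<in> claw_edges n. x \<noteq> Root n} = dart_arc (Suc n) ` ?L" .
  \<comment> \<open>The old root edge splits into \<open>Out n j\<close> and
    \<open>Down n j\<close>, the latter now starting at \<open>Mid n j\<close>.\<close>
  moreover have "(\<Union>(j, y) \<in> {(j, y). (Root n, j, y) \<in> claw_edges n}.
        {(Root n, j, Mid n j), (Mid n j, j, y)})
      = dart_arc (Suc n) ` ({Down n j | j. j < 3} \<union> {Out n j | j. j < 3})"
  proof -
    have "{Down n j | j. j < 3} = Down n ` {..<3}" "{Out n j | j. j < 3} = Out n ` {..<3}"
      by auto
    then show ?thesis
      unfolding root by (auto simp: image_Un image_image dart_arc_def)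
  qed
  moreover have "{(Root (Suc n), j, Mid n j) | j. j < 3} = dart_arc (Suc n) ` {Down (Suc n) j | j. j < 3}"
    by (force simp: dart_arc_def)
  moreover have "?E (Suc n) = ({Down l j | l j. l < n \<and> j < 3} \<union> {Out l j | l j. l < n \<and> j < 3})
      \<union> ({Down n j | j. j < 3} \<union> {Out n j | j. j < 3}) \<union> {Down (Suc n) j | j. j < 3}"
    by (auto simp: le_Suc_eq less_Suc_eq le_less)
  ultimately show ?case
    by (simp only: claw_edges.simps image_Un)
qed

lemma dart_arc_image: "dart_arc n ` darts n = arcs (iterated_claw n)"
proof -
  let ?E = "{Down l j | l j. l \<le> n \<and> j < 3} \<union> {Out l j | l j. l < n \<and> j < 3}"
  have "darts n = ?E \<union> dart_rev ` ?E"
    by (auto simp: darts_def image_iff eq_commute[of _ "dart_rev _"] dart_rev_eq_iff)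
  then show ?thesis
    by (simp add: iterated_claw_def claw_edges_eq image_Un image_image rev_dart_arc)
qed

lemma bij_dart_arc: "bij_betw (dart_arc n) (darts n) (arcs (iterated_claw n))"
  by (simp add: bij_betw_def inj_dart_arc dart_arc_image)

lemma vertex_dart_props:
  assumes "v \<in> claw_verts n" "k < 3"
  shows "vertex_dart n v k \<in> darts n" "dart_src n (vertex_dart n v k) = v"
  using assms unfolding less_3_iff
  by (cases v; auto simp: darts_def claw_verts_bounds)+

lemma dart_eq_vertex_dart:
  assumes "d \<in> darts n"
  shows "dart_src n d \<in> claw_verts n \<and> (\<exists>k<3. d = vertex_dart n (dart_src n d) k)"
proof -
  have "Base \<in> claw_verts n"
    by (simp add: claw_verts_eq lower_verts_bounds)
  moreover have "k = 0 \<or> k = 1 \<or> k = 2 \<Longrightarrow> k < 3" for k :: nat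
    by auto
  ultimately show ?thesis
    using assms
    by (cases d)
       (force simp: darts_def claw_verts_bounds split: nat.splits
         intro: exI[of _ 0] exI[of _ 1] exI[of _ 2])+
qed

lemma cubic_iterated_claw: "cubic_digraph (iterated_claw n) (\<lambda>v k. dart_arc n (vertex_dart n v k))"
proof -
  interpret fin_digraph "iterated_claw n"
    by (rule fin_digraph_iterated_claw)
  show ?thesis
  proof
    fix v assume "v \<in> verts (iterated_claw n)"
    then have v: "v \<in> claw_verts n"
      by (simp add: iterated_claw_def)
    have tail: "tail (iterated_claw n) (dart_arc n d) = dart_src n d" for d
      by (simp add: iterated_claw_def dart_arc_def)
    have "inj_on (vertex_dart n v) {..<3}"
      unfolding lessThan_3 by (cases v) (auto simp: inj_on_def)
    then have "inj_on (\<lambda>k. dart_arc n (vertex_dart n v k)) {..<3}"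
      using inj_dart_arc[of n] vertex_dart_props(1)[OF v] by (auto simp: inj_on_def)
    moreover have "(\<lambda>k. dart_arc n (vertex_dart n v k)) ` {..<3} = out_arcs (iterated_claw n) v"
    proof (intro equalityI subsetI)
      fix a assume "a \<in> out_arcs (iterated_claw n) v"
      then obtain d where "d \<in> darts n" "a = dart_arc n d" "dart_src n d = v"
        by (auto simp: dart_arc_image[symmetric] tail)
      then obtain k where "k < 3" "d = vertex_dart n v k"
        using dart_eq_vertex_dart[of d n] by blast
      then show "a \<in> (\<lambda>k. dart_arc n (vertex_dart n v k)) ` {..<3}"
        using \<open>a = dart_arc n d\<close> by simp
    qed (use vertex_dart_props[OF v] in \<open>auto simp: tail dart_arc_image[symmetric]\<close>)
    ultimately show "bij_betw (\<lambda>k. dart_arc n (vertex_dart n v k)) {..<3} (out_arcs (iterated_claw n) v)"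
      by (simp add: bij_betw_def)
  qed
qed

text \<open>\<open>Up l j\<close> leads to \<open>Down l j\<close> while \<open>Root l\<close> is
  open and is redirected once \<open>Mid l j\<close> exists; every other dart has its final
  successor from its creation on.\<close>

lemma cut_perm_eq:
  assumes "d \<in> darts n"
  shows "cut_perm n S d = (case d of
      Down l j \<Rightarrow> (case l of 0 \<Rightarrow> Up 0 (turn (Base \<in> S) j)
        | Suc m \<Rightarrow> if Mid m j \<in> S then Down m j else In m j)
    | Up l j \<Rightarrow> if l = n then Down n j else if Mid l j \<in> S then In l j else Up (Suc l) j
    | Out l j \<Rightarrow> if Mid l j \<in> S then Up (Suc l) j else Down l j
    | In l j \<Rightarrow> Out l (turn (Root l \<in> S) j))"
  using assms
proof (induction n)
  case 0
  then show ?case by (auto simp: darts_def base_perm_def)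
next
  case (Suc n)
  show ?case
  proof (cases "d \<in> darts n")
    case True
    then show ?thesis
      using Suc.IH[OF True] by (auto simp: darts_def attach_claw_def split: nat.splits)
  next
    case False
    then have "cut_perm n S d = d"
      using cut_perm_permutes by (rule permutes_not_in[rotated])
    then show ?thesis
      using Suc.prems False
      by (auto simp: darts_def attach_claw_def le_Suc_eq less_Suc_eq split: nat.splits)
  qed
qed

lemma full_perm_eq:
  assumes "d \<in> darts n" "dart_rev d = vertex_dart n v k" "v \<in> claw_verts n" "k < 3"
  shows "full_perm n S d = vertex_dart n v (turn (v \<in> S) k)"
proof -
  have d: "d = dart_rev (vertex_dart n v k)"
    using assms(2) by (simp add: dart_rev_eq_iff)
  note cut = cut_perm_eq[OF assms(1), of S]
  show ?thesis
  proof (cases v)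
    case Base
    then show ?thesis
      using cut by (simp add: d full_perm_def port_perm_def)
  next
    case (Root l)
    have "map (turn (Root n \<in> S)) [0, 1, 2] ! k = turn (Root n \<in> S) k"
      using assms(4) unfolding less_3_iff by auto
    then show ?thesis
      using cut assms(4) by (cases "l = n") (simp_all add: d Root full_perm_def port_perm_def)
  next
    case (Mid l j)
    then have "l < n" using assms(3) by (simp add: claw_verts_bounds)
    then show ?thesis
      using cut assms(4) unfolding less_3_iff
      by (elim disjE; cases "Mid l j \<in> S")
         (simp_all add: d Mid full_perm_def port_perm_def turn_def)
  qed
qed

lemma card_faces:
  "card (faces (iterated_claw n) (claw_rev n)
      (cubic_rotation (iterated_claw n) (\<lambda>v k. dart_arc n (vertex_dart n v k)) S))
    = num_orbits (full_perm n S) (darts n)"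
proof -
  let ?\<rho> = "cubic_rotation (iterated_claw n) (\<lambda>v k. dart_arc n (vertex_dart n v k)) S"
  interpret cubic_digraph "iterated_claw n" "\<lambda>v k. dart_arc n (vertex_dart n v k)"
    by (rule cubic_iterated_claw)
  have comm: "(?\<rho> \<circ> claw_rev n) (dart_arc n d) = dart_arc n (full_perm n S d)" if d: "d \<in> darts n" for d
  proof -
    have "dart_arc n d \<in> arcs (iterated_claw n)"
      using d dart_arc_image by blast
    then have "claw_rev n (dart_arc n d) = dart_arc n (dart_rev d)"
      by (simp add: claw_rev_def rev_dart_arc)
    moreover obtain v k where vk: "v \<in> claw_verts n" "k < 3" "dart_rev d = vertex_dart n v k"
      using dart_eq_vertex_dart[OF dart_rev_in_darts[OF d]] by blast
    moreover have "v \<in> verts (iterated_claw n)"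
      using vk(1) by (simp add: iterated_claw_def)
    ultimately show ?thesis
      using full_perm_eq[OF d] by (simp add: cubic_rotation_out)
  qed
  \<comment> \<open>An arc is exhibited because \<open>faces\<close> treats the edgeless graph
    separately.\<close>
  have "Down 0 0 \<in> darts n"
    by (simp add: darts_def)
  then have "arcs (iterated_claw n) \<noteq> {}"
    using dart_arc_image by blast
  then show ?thesis
    using num_orbits_conjugate[OF bij_dart_arc full_perm_permutes comm] unfolding faces_def by presburger
qed

section \<open>Vertices, edges and Euler's formula\<close>

lemma card_darts: "card (darts n) = 12 * n + 6"
proof (induction n)
  case 0
  have "darts 0 = {Down 0 0, Down 0 1, Down 0 2, Up 0 0, Up 0 1, Up 0 2}"
    unfolding darts_0 ports_def lessThan_3 by auto
  then show ?case by simp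
next
  case (Suc n)
  have "card (ports (Suc n) \<union> claw_darts n) = 12"
    unfolding ports_def claw_darts_def lessThan_3 by simp
  moreover have "darts n \<inter> (ports (Suc n) \<union> claw_darts n) = {}"
    by (auto simp: darts_def ports_def claw_darts_def)
  moreover have "finite (ports (Suc n) \<union> claw_darts n)"
    by (simp add: ports_def claw_darts_def)
  ultimately show ?case
    using Suc by (simp add: darts_Suc Un_assoc card_Un_disjoint finite_darts)
qed

lemma card_claw_verts: "card (claw_verts n) = 4 * n + 2"
proof -
  have "card (lower_verts n) = 4 * n + 1"
    by (induction n) (simp_all add: finite_lower_verts lower_verts_bounds)
  then show ?thesis
    by (simp add: claw_verts_eq finite_lower_verts lower_verts_bounds)
qed

lemma num_embeddings_claw:
  "num_embeddings (iterated_claw n) (claw_rev n) i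
    = card {S \<in> Pow (claw_verts n). num_orbits (full_perm n S) (darts n) + 2 * i = 2 * n + 3}"
proof -
  let ?out = "\<lambda>v k. dart_arc n (vertex_dart n v k)"
  interpret cubic_digraph "iterated_claw n" ?out
    by (rule cubic_iterated_claw)
  have verts: "verts (iterated_claw n) = claw_verts n"
    by (simp add: iterated_claw_def)
  have arcs: "card (arcs (iterated_claw n)) = 12 * n + 6"
    using bij_betw_same_card[OF bij_dart_arc] card_darts by metis
  \<comment> \<open>With 4n + 2 vertices, 6n + 3 edges and F faces, Euler characteristic 2 - 2i
    means F + 2i = 2n + 3.\<close>
  have euler: "euler_char (iterated_claw n) (claw_rev n) (cubic_rotation (iterated_claw n) ?out S) = 2 - 2 * int i
      \<longleftrightarrow> num_orbits (full_perm n S) (darts n) + 2 * i = 2 * n + 3" for S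
  proof -
    have "(12 * n + 6) div 2 = 6 * n + 3" by simp
    then show ?thesis
      unfolding euler_char_def card_faces verts arcs card_claw_verts by linarith
  qed
  define R where "R = cubic_rotation (iterated_claw n) ?out"
  have R: "R ` Pow (claw_verts n) = {\<rho>. rotation_system (iterated_claw n) \<rho>}" "inj_on R (Pow (claw_verts n))"
    using bij_cubic_rotation unfolding bij_betw_def verts R_def by simp_all
  have "embeddings (iterated_claw n) (claw_rev n) i
      = {\<rho> \<in> R ` Pow (claw_verts n). euler_char (iterated_claw n) (claw_rev n) \<rho> = 2 - 2 * int i}"
    unfolding R embeddings_def by simp
  also have "\<dots> = R ` {S \<in> Pow (claw_verts n). num_orbits (full_perm n S) (darts n) + 2 * i = 2 * n + 3}"
    using euler[folded R_def] by auto
  finally have "embeddings (iterated_claw n) (claw_rev n) i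
      = R ` {S \<in> Pow (claw_verts n). num_orbits (full_perm n S) (darts n) + 2 * i = 2 * n + 3}" .
  moreover have "inj_on R {S \<in> Pow (claw_verts n). num_orbits (full_perm n S) (darts n) + 2 * i = 2 * n + 3}"
    using R(2) by (rule inj_on_subset) blast
  ultimately show ?thesis
    unfolding num_embeddings_def by (simp only: card_image)
qed

section \<open>Recurrences for the coefficients\<close>

text \<open>
  The index \<open>j\<close> is \<open>n + 1 - i\<close> for the genus \<open>i\<close>, so that \<open>2 * j + 1\<close> is the number of faces. For a
  transposition \<open>f\<close> is odd, hence the shift in \<open>transp_count\<close>.
\<close>

definition id_count :: "nat \<Rightarrow> nat \<Rightarrow> int" where
  "id_count n j = int (state_sum n (\<lambda>k f. of_bool (k = 0 \<and> f = 2 * j)))"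

definition transp_count :: "nat \<Rightarrow> nat \<Rightarrow> int" where
  "transp_count n j = int (state_sum n (\<lambda>k f. of_bool (k = 1 \<and> f + 1 = 2 * j)))"

definition cycle_count :: "nat \<Rightarrow> nat \<Rightarrow> int" where
  "cycle_count n j = int (state_sum n (\<lambda>k f. of_bool (k = 2 \<and> f = 2 * j)))"

definition shifted :: "(nat \<Rightarrow> int) \<Rightarrow> nat \<Rightarrow> int" where
  "shifted a j = (case j of 0 \<Rightarrow> 0 | Suc i \<Rightarrow> a i)"

text \<open>Both root orientations add one face to an identity and two to a transposition. For a
  3-cycle one adds a single face and the other three, whence the shifted term.\<close>

definition genus_count :: "nat \<Rightarrow> nat \<Rightarrow> int" where
  "genus_count n j = 2 * id_count n j + 2 * transp_count n j + cycle_count n j + shifted (cycle_count n) j"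

lemma state_sum_add: "state_sum n (\<lambda>k f. g k f + h k f) = state_sum n g + state_sum n h"
  by (simp add: state_sum_def sum.distrib)

lemma state_sum_mult: "state_sum n (\<lambda>k f. c * h k f) = c * state_sum n h"
  by (simp add: state_sum_def sum_distrib_left)

lemma state_sum_cong:
  assumes "\<And>k f. k < 3 \<Longrightarrow> g k f = h k f"
  shows "state_sum n g = state_sum n h"
  unfolding state_sum_def using assms by (intro sum.cong refl) (simp add: perm_class_def)

lemma shifted_state_sum:
  "shifted (\<lambda>j. int (state_sum n (\<lambda>k f. of_bool (k = c \<and> f = 2 * j)))) i
     = int (state_sum n (\<lambda>k f. of_bool (k = c \<and> f + 2 = 2 * i)))"
  by (cases i) (simp_all add: shifted_def state_sum_def)

text \<open>This recurrence and the next two are the columns of the transfer matrix, read off by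
  putting indicator functions into \<open>class_sum\<close>.\<close>

lemma id_count_Suc: "id_count (Suc n) j = 2 * cycle_count n j"
proof -
  have "state_sum (Suc n) (\<lambda>k f. of_bool (k = 0 \<and> f = 2 * j))
      = state_sum n (\<lambda>k f. 2 * of_bool (k = 2 \<and> f = 2 * j))"
    unfolding state_sum_Suc by (rule state_sum_cong) (auto simp: class_sum_def)
  then show ?thesis
    by (simp add: id_count_def cycle_count_def state_sum_mult)
qed

lemma transp_count_Suc:
  "transp_count (Suc n) j = 12 * transp_count n j + 6 * shifted (cycle_count n) j"
proof -
  have "state_sum (Suc n) (\<lambda>k f. of_bool (k = 1 \<and> f + 1 = 2 * j))
      = state_sum n (\<lambda>k f. 12 * of_bool (k = 1 \<and> f + 1 = 2 * j) + 6 * of_bool (k = 2 \<and> f + 2 = 2 * j))"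
    unfolding state_sum_Suc by (rule state_sum_cong) (auto simp: class_sum_def)
  moreover have "shifted (cycle_count n) j = int (state_sum n (\<lambda>k f. of_bool (k = 2 \<and> f + 2 = 2 * j)))"
    using shifted_state_sum[of n 2 j] by (simp add: cycle_count_def[abs_def])
  ultimately show ?thesis
    by (simp add: transp_count_def state_sum_mult state_sum_add)
qed

lemma cycle_count_Suc:
  "cycle_count (Suc n) j = 16 * id_count n j + 4 * transp_count n j + 8 * cycle_count n j"
proof -
  have "state_sum (Suc n) (\<lambda>k f. of_bool (k = 2 \<and> f = 2 * j))
      = state_sum n (\<lambda>k f. 16 * of_bool (k = 0 \<and> f = 2 * j) + 4 * of_bool (k = 1 \<and> f + 1 = 2 * j)
          + 8 * of_bool (k = 2 \<and> f = 2 * j))"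
    unfolding state_sum_Suc by (rule state_sum_cong) (auto simp: class_sum_def)
  then show ?thesis
    by (simp add: id_count_def transp_count_def cycle_count_def state_sum_mult state_sum_add)
qed

lemma counts_0:
  "id_count 0 j = 0" "transp_count 0 j = 0" "cycle_count 0 j = of_bool (j = 0) * 2"
  by (auto simp: id_count_def transp_count_def cycle_count_def state_sum_0)

lemma sum_full_perm_genus:
  "int (\<Sum>S\<in>Pow (claw_verts n). of_bool (num_orbits (full_perm n S) (darts n) = 2 * j + 1))
     = genus_count n j"
proof -
  have "(\<Sum>S\<in>Pow (claw_verts n). of_bool (num_orbits (full_perm n S) (darts n) = 2 * j + 1))
      = state_sum n (\<lambda>k f. 2 * of_bool (k = 0 \<and> f = 2 * j) + 2 * of_bool (k = 1 \<and> f + 1 = 2 * j)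
          + (of_bool (k = 2 \<and> f = 2 * j) + of_bool (k = 2 \<and> f + 2 = 2 * j)))"
    by (rule trans[OF sum_full_perm[where h = "\<lambda>x. of_bool (x = 2 * j + 1)"]], rule state_sum_cong) auto
  moreover have "shifted (cycle_count n) j = int (state_sum n (\<lambda>k f. of_bool (k = 2 \<and> f + 2 = 2 * j)))"
    using shifted_state_sum[of n 2 j] by (simp add: cycle_count_def[abs_def])
  ultimately show ?thesis
    by (simp add: id_count_def transp_count_def cycle_count_def genus_count_def state_sum_mult state_sum_add)
qed

section \<open>Support and positivity of the counts\<close>

lemma counts_nonneg: "id_count n j \<ge> 0" "transp_count n j \<ge> 0" "cycle_count n j \<ge> 0"
    "shifted (cycle_count n) j \<ge> 0"
  by (auto simp: id_count_def transp_count_def cycle_count_def shifted_def split: nat.splits)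

lemma shifted_simps [simp]: "shifted a 0 = 0" "shifted a (Suc i) = a i"
  by (simp_all add: shifted_def)

text \<open>For \<open>2 * j < n\<close> the summand with factor 8 carries positivity over from
  \<open>n - 1\<close>. For \<open>2 * j = n > 0\<close> two steps are needed: a 3-cycle passes to a
  transposition and back and closes two faces.\<close>

lemma cycle_count_pos: "2 * j \<le> n \<Longrightarrow> cycle_count n j > 0"
proof (induction n arbitrary: j rule: less_induct)
  case (less n)
  show ?case
  proof (cases n)
    case 0
    then show ?thesis using less.prems by (simp add: counts_0)
  next
    case (Suc m)
    show ?thesis
    proof (cases "2 * j \<le> m")
      case True
      then have "cycle_count m j > 0" using less.IH Suc by simp
      then show ?thesis
        using counts_nonneg[of m j] by (simp add: Suc cycle_count_Suc)
    next
      case False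
      then obtain i l where il: "j = Suc i" "m = Suc l" "2 * i \<le> l"
        using less.prems Suc by (cases j; cases m) auto
      then have "cycle_count l i > 0" using less.IH Suc by simp
      then have "transp_count m j > 0"
        using counts_nonneg[of l j] by (simp add: il transp_count_Suc)
      then show ?thesis
        using counts_nonneg[of m j] by (simp add: Suc cycle_count_Suc)
    qed
  qed
qed

lemma counts_eq_0:
  "(n < 2 * j \<longrightarrow> cycle_count n j = 0 \<and> id_count n j = 0) \<and> (n + 1 < 2 * j \<longrightarrow> transp_count n j = 0)"
proof (induction n arbitrary: j)
  case 0
  then show ?case by (auto simp: counts_0)
next
  case (Suc n)
  show ?case
    using Suc[of j] Suc[of "j - 1"]
    by (cases j) (auto simp: cycle_count_Suc id_count_Suc transp_count_Suc)
qed

lemma genus_count_pos: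
  assumes "2 * j \<le> n + 2"
  shows "genus_count n j > 0"
proof (cases j)
  case 0
  then show ?thesis
    using cycle_count_pos[of 0 n] counts_nonneg[of n j] by (simp add: genus_count_def)
next
  case (Suc i)
  \<comment> \<open>At the extreme \<open>2 * j = n + 2\<close> the shifted term is the only one
    that does not vanish.\<close>
  then have "cycle_count n i > 0"
    using assms by (intro cycle_count_pos) simp
  then show ?thesis
    using counts_nonneg[of n j] by (simp add: genus_count_def Suc)
qed

lemma genus_count_eq_0: "n + 2 < 2 * j \<Longrightarrow> genus_count n j = 0"
  using counts_eq_0[of n j] counts_eq_0[of n "j - 1"] by (cases j) (auto simp: genus_count_def)

text \<open>Cayley-Hamilton: with y for the shift, the transfer matrix has the characteristic
  polynomial x^3 - 20 x^2 + (64 - 24 y) x + 384. The case splits resolve the nested shifts.\<close>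

lemma genus_count_rec:
  "genus_count (n + 3) j = 20 * genus_count (n + 2) j - 64 * genus_count (n + 1) j
     - 384 * genus_count n j + 24 * shifted (genus_count (n + 1)) j"
  by (cases j rule: nat.exhaust; cases "j - 1")
     (simp_all add: genus_count_def eval_nat_numeral cycle_count_Suc id_count_Suc transp_count_Suc algebra_simps)

lemma shifted_genus_count_nonneg: "shifted (genus_count n) j \<ge> 0"
  by (cases j) (simp_all add: genus_count_def counts_nonneg)

lemma genus_count_initial:
  assumes "j \<ge> 1"
  shows "genus_count 0 j = of_bool (j = 1) * 2" "genus_count 1 j = of_bool (j = 1) * 40"
    "genus_count 2 j = of_bool (j = 1) * 720 + of_bool (j = 2) * 48"
  using assms
  by (cases j rule: nat.exhaust; cases "j - 1";
      simp add: genus_count_def eval_nat_numeral cycle_count_Suc id_count_Suc transp_count_Suc counts_0)+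

text \<open>The recurrence propagates the ratio 11 because \<open>64 / 11 + 384 / 11\<^sup>2 < 20 - 11\<close>.\<close>

lemma genus_count_ge:
  assumes "j \<ge> 1"
  shows "11 * genus_count n j \<le> genus_count (Suc n) j"
proof (induction n rule: less_induct)
  case (less n)
  consider "n = 0" | "n = 1" | m where "n = m + 2"
    by (metis One_nat_def add_2_eq_Suc' not0_implies_Suc)
  then show ?case
  proof cases
    case (3 m)
    have "11 * genus_count m j \<le> genus_count (m + 1) j" "11 * genus_count (m + 1) j \<le> genus_count (m + 2) j"
      using less.IH[of m] less.IH[of "m + 1"] 3 by simp_all
    moreover have eq: "Suc (m + 2) = m + 3"
      by simp
    moreover have "genus_count m j \<ge> 0"
      by (simp add: genus_count_def counts_nonneg)
    ultimately show ?thesis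
      using genus_count_rec[of m j] shifted_genus_count_nonneg[of "m + 1" j] unfolding 3 eq by linarith
  qed (use genus_count_initial[OF assms] in \<open>auto simp: numeral_2_eq_2\<close>)
qed

text \<open>From \<open>n = 2\<close> on, strictness comes from the surplus 9 - 64/11 - 384/121 =
  1/121 times the positive \<open>genus_count n j\<close>. Index 0 is excluded: its growth rate 4 (1
  + \<surd>3) is below 11.\<close>

lemma genus_count_gt:
  assumes "j \<ge> 1" "2 * j \<le> n + 2"
  shows "11 * genus_count n j < genus_count (Suc n) j"
proof -
  consider "n = 0" | "n = 1" | m where "n = m + 2"
    by (metis One_nat_def add_2_eq_Suc' not0_implies_Suc)
  then show ?thesis
  proof cases
    case (3 m)
    have "11 * genus_count m j \<le> genus_count (m + 1) j" "11 * genus_count (m + 1) j \<le> genus_count (m + 2) j"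
      using genus_count_ge[OF assms(1)] by simp_all
    moreover have eq: "Suc (m + 2) = m + 3"
      by simp
    ultimately show ?thesis
      using genus_count_rec[of m j] shifted_genus_count_nonneg[of "m + 1" j] genus_count_pos[OF assms(2)]
      unfolding 3 eq by linarith
  next
    case 1
    then have "j = 1" using assms by simp
    then show ?thesis
      using genus_count_initial[OF assms(1)] 1 by simp
  next
    case 2
    then have "j = 1" using assms by simp
    then show ?thesis
      using genus_count_initial[OF assms(1)] 2 by (simp add: numeral_2_eq_2)
  qed
qed

text \<open>The coefficient of \<surd>3 in (1 + \<surd>3)^m, and \<open>binom_even\<close> the
  rational part. Terms past the middle vanish; the generous upper bound eases the recursion.\<close>

definition binom_odd :: "nat \<Rightarrow> int" where
  "binom_odd m = (\<Sum>k\<le>m. int (m choose (2 * k + 1)) * 3 ^ k)"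

definition binom_even :: "nat \<Rightarrow> int" where
  "binom_even m = (\<Sum>k\<le>m. int (m choose (2 * k)) * 3 ^ k)"

text \<open>Multiplying a + b \<surd>3 by 1 + \<surd>3 gives (a + 3 b) + (a + b) \<surd>3, hence
  this and the next recurrence.\<close>

lemma binom_odd_Suc: "binom_odd (Suc m) = binom_odd m + binom_even m"
proof -
  have "binom_odd (Suc m) = (\<Sum>k\<le>m. int (Suc m choose (2 * k + 1)) * 3 ^ k)"
    by (simp add: binom_odd_def binomial_eq_0 del: binomial_Suc_Suc)
  then show ?thesis
    by (simp add: binom_odd_def binom_even_def algebra_simps sum.distrib)
qed

lemma binom_even_Suc: "binom_even (Suc m) = binom_even m + 3 * binom_odd m"
proof -
  have "binom_even m = (\<Sum>k\<le>Suc m. int (m choose (2 * k)) * 3 ^ k)"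
    by (simp add: binom_even_def)
  also have "\<dots> = 1 + (\<Sum>k\<le>m. int (m choose (2 * k + 2)) * 3 ^ (k + 1))"
    by (subst sum.atMost_Suc_shift) simp
  finally show ?thesis
    unfolding binom_even_def[of "Suc m"] sum.atMost_Suc_shift
    by (simp add: binom_odd_def algebra_simps sum.distrib sum_distrib_left)
qed

lemma genus_count_leading: "genus_count n 0 = 4 ^ n * binom_odd (n + 2)"
proof (induction n rule: less_induct)
  case (less n)
  \<comment> \<open>Without transpositions the factor x - 12 of the characteristic polynomial at y =
    0 drops out, leaving x^2 - 8 x - 32 with the roots 4 (1 \<plusminus> \<surd>3).\<close>
  have transp: "transp_count m 0 = 0" for m
    by (induction m) (simp_all add: counts_0 transp_count_Suc)
  consider "n = 0" | "n = 1" | m where "n = m + 2"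
    by (metis One_nat_def add_2_eq_Suc' not0_implies_Suc)
  then show ?case
  proof cases
    case (3 m)
    have "genus_count (m + 2) 0 = 8 * genus_count (m + 1) 0 + 32 * genus_count m 0"
      by (simp add: genus_count_def transp cycle_count_Suc id_count_Suc)
    then show ?thesis
      using less.IH[of m] less.IH[of "m + 1"] 3
      by (simp add: binom_odd_Suc binom_even_Suc algebra_simps)
  qed (simp_all add: genus_count_def counts_0 transp cycle_count_Suc id_count_Suc
        binom_odd_def numeral_2_eq_2 numeral_3_eq_3)
qed

lemma binom_odd_eq: "binom_odd (n + 2) = (\<Sum>k=0..(n + 1) div 2. int ((n + 2) choose (2 * k + 1)) * 3 ^ k)"
  unfolding binom_odd_def
  by (rule sum.mono_neutral_right) (auto simp: binomial_eq_0 simp del: binomial_Suc_Suc)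

section \<open>The genus polynomials of the iterated claws\<close>

lemma coeff_claw_genus_poly:
  "coeff (claw_genus_poly n) i = (if i \<le> n + 1 then genus_count n (n + 1 - i) else 0)"
proof -
  have "finite (arcs (iterated_claw n))"
    using fin_digraph.finite_arcs[OF fin_digraph_iterated_claw] .
  then have coeff: "coeff (claw_genus_poly n) i
      = int (card {S \<in> Pow (claw_verts n). num_orbits (full_perm n S) (darts n) + 2 * i = 2 * n + 3})"
    by (simp only: claw_genus_poly_def coeff_genus_poly num_embeddings_claw)
  have fin: "finite (Pow (claw_verts n))"
    by (simp add: finite_claw_verts)
  show ?thesis
  proof (cases "i \<le> n + 1")
    case True
    define j where "j = n + 1 - i"
    \<comment> \<open>\<open>j = 0\<close> is the maximal genus, with a single face.\<close>
    have "m + 2 * i = 2 * n + 3 \<longleftrightarrow> m = 2 * j + 1" for m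
      using True unfolding j_def by linarith
    then show ?thesis
      using True sum_full_perm_genus[of n j] fin
      unfolding coeff j_def[symmetric] by (simp add: sum_of_bool_eq Collect_conj_eq Pow_def)
  next
    case False
    then have "m + 2 * i \<noteq> 2 * n + 3" for m
      by linarith
    then show ?thesis
      using False unfolding coeff by simp
  qed
qed

theorem theorem3p3:
  fixes n :: nat
  shows "claw_genus_poly n \<in> pos_polys ((n + 1) div 2) (n + 1)
    \<and> (\<forall>i. (n + 1) div 2 \<le> i \<and> i \<le> n + 1 \<longrightarrow> coeff (claw_genus_poly n) i > 0)
    \<and> (\<forall>i. \<not> ((n + 1) div 2 \<le> i \<and> i \<le> n + 1) \<longrightarrow> coeff (claw_genus_poly n) i = 0)
    \<and> coeff (claw_genus_poly n) (n + 1) =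
        4 ^ n * (\<Sum>k=0..(n + 1) div 2. int ((n + 2) choose (2 * k + 1)) * 3 ^ k)
    \<and> (\<forall>i. (n + 1) div 2 + 1 \<le> i \<and> i \<le> n \<longrightarrow>
        coeff (claw_genus_poly n) i > 11 * coeff (claw_genus_poly (n - 1)) (i - 1))"
proof -
  let ?P = "claw_genus_poly n" and ?s = "(n + 1) div 2"
  have pos: "coeff ?P i > 0" if "?s \<le> i" "i \<le> n + 1" for i
    using that by (simp add: coeff_claw_genus_poly genus_count_pos)
  have zero: "coeff ?P i = 0" if "\<not> (?s \<le> i \<and> i \<le> n + 1)" for i
    using that by (auto simp: coeff_claw_genus_poly intro!: genus_count_eq_0)
  have "?P = (\<Sum>k=?s..n + 1. monom (coeff ?P k) k)"
  proof (rule poly_eqI)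
    fix i
    show "coeff ?P i = coeff (\<Sum>k=?s..n + 1. monom (coeff ?P k) k) i"
    proof (cases "i \<in> {?s..n + 1}")
      case True
      then show ?thesis by (simp only: coeff_sum coeff_monom sum.delta finite_atLeastAtMost if_True)
    next
      case False
      then show ?thesis using zero[of i] by (simp add: coeff_sum)
    qed
  qed
  then have mem: "?P \<in> pos_polys ?s (n + 1)"
    unfolding pos_polys_def using pos by (intro CollectI exI[of _ "coeff ?P"]) simp
  have lead: "coeff ?P (n + 1) = 4 ^ n * (\<Sum>k=0..?s. int ((n + 2) choose (2 * k + 1)) * 3 ^ k)"
    unfolding binom_odd_eq[symmetric] genus_count_leading[symmetric]
    by (simp add: coeff_claw_genus_poly)
  have ratio: "coeff ?P i > 11 * coeff (claw_genus_poly (n - 1)) (i - 1)" if i: "?s + 1 \<le> i" "i \<le> n" for i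
  proof -
    obtain m where m: "n = Suc m"
      using i by (cases n) auto
    define j where "j = n + 1 - i"
    \<comment> \<open>Genus \<open>i\<close> for \<open>n\<close> and \<open>i - 1\<close> for
      \<open>n - 1\<close> share the same \<open>j\<close>, that is the same number of faces;
      \<open>i \<le> n\<close> becomes \<open>j \<ge> 1\<close>.\<close>
    have j: "j \<ge> 1" "2 * j \<le> m + 2" "m + 1 - (i - 1) = j" "i - 1 \<le> m + 1" "i \<le> n + 1"
      using i unfolding j_def m by linarith+
    then show ?thesis
      using genus_count_gt[OF j(1,2)] by (simp add: coeff_claw_genus_poly m j_def)
  qed
  show ?thesis
    using mem pos zero lead ratio by blast
qed

end
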